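(* For each integer $k>1$ and each real number $a\in(0,1)$ there exists a real number $\rho>0$ such that $$G(z)=\rho z(z^k-a^k),\qquad dh=\frac{a^k-z^k}{z(z^k-1)^2}\,dz$$ is the Weierstrass data for a minimal surface on $\Sigma=\overline{\mathbb{C}}\setminus\left(\{0,\infty\}\cup\{z\in\mathbb{C}: z^k=1\}\right)$ which has a horizontal planar end at $z=\infty$, a downward pointing vertical catenoid end at $z=0$, and an upward pointing non-vertical catenoid end at each $k$-th root of unity.
   Context: Let $\overline{\mathbb{C}}$ be the Riemann sphere and $\Sigma=\overline{\mathbb{C}}\setminus\{p_1,\dots,p_n\}$ a punctured sphere. Let $G$ be a meromorphic function and $dh$ a meromorphic one-form (the height differential) on $\overline{\mathbb{C}}$. The pair $(G,dh)$ is the Weierstrass data for a minimal surface on $\Sigma$ if the following two conditions hold. (i) (Period problem) The map $X:\Sigma\to\mathbb{R}^3$, $$X(z)=\operatorname{Re}\int_{z_0}^z\left(\frac12\left(\frac1G-G\right)dh,\ \frac i2\left(\frac1G+G\right)dh,\ dh\right),\qquad z_0\in\Sigma,$$ is well defined, i.e. the real part of the integral of this triple over every closed curve in $\Sigma$ is $(0,0,0)$. Equivalently, at every puncture $p_j$ the residues of $\left(\frac1G-G\right)dh$, $i\left(\frac1G+G\right)dh$ and $dh$ are real. (ii) (Regularity) $dh$ is holomorphic on $\Sigma$, and $G$ has a zero or pole at $p\in\Sigma$ if and only if $dh$ has a zero at $p$ of the same multiplicity, so that $X$ is a conformal minimal immersion. $G$ is the composition of stereographic projection with the Gauss map of $X$.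 $G=0$ corresponds to the downward vertical normal and $G=\infty$ to the upward vertical normal. The punctures $p_j$ are the ends of the surface. Types of ends. Let $N$ be the limiting unit normal of $X$ at an end $p_j$ (determined by $G(p_j)$). The end is a planar end (respectively a catenoid end) if $X$ restricted to a small punctured neighbourhood of $p_j$ is an embedding whose image, outside a compact set, is a graph over the exterior of a bounded domain in the plane orthogonal to $N$, with height function in the direction $N$ of the form $c\log r+d+O(1/r)$, where $r$ is the distance to the origin in that plane, and where $c=0$ for a planar end (respectively $c\neq0$ for a catenoid end). A planar end is horizontal if $N$ is vertical, i.e. $N=(0,0,\pm1)$. A catenoid end is vertical if $N=(0,0,\pm1)$ (i.e. $G(p_j)\in\{0,\infty\}$) and non-vertical otherwise. A catenoid end points in the direction $\nu\in\{N,-N\}$ for which the height in the direction $\nu$ tends to $+\infty$ at the end. It is upward pointing if the third coordinate of $\nu$ is positive and downward pointing if the third coordinate of $\nu$ is negative. *)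

theory Defs
  imports "HOL-Complex_Analysis.Complex_Analysis"
begin

text \<open>
  The Riemann sphere is the one-point compactification of the complex plane, with \<^const>\<open>None\<close> as
  the point at infinity. Meromorphic functions on it are given by their values on the plane;
  meromorphic one-forms by their coefficient \<open>h\<close> with respect to \<open>dz\<close>, that is \<open>h(z) dz\<close>.
  Values at poles and removable singularities are irrelevant: only limits are used.
\<close>

type_synonym sphere = "complex option"

definition riemann_sphere :: "sphere topology" where
  "riemann_sphere = Alexandroff_compactification euclidean"

text \<open>
  Local coordinate \<open>w\<close> centred at a point: \<open>w = z - a\<close> at \<open>a\<close> and \<open>w = 1/z\<close> at infinity.
  The points \<open>z = \<infinity>\<close> (first chart) and \<open>z = 0\<close> (second chart) are outside the domain of the chart
  and get the dummy value 0; all uses are local around the centre.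
\<close>

fun local_coord :: "sphere \<Rightarrow> sphere \<Rightarrow> complex" where
  "local_coord (Some a) (Some z) = z - a"
| "local_coord (Some a) None = 0"
| "local_coord None (Some z) = 1 / z"
| "local_coord None None = 0"

fun local_fun :: "(complex \<Rightarrow> complex) \<Rightarrow> sphere \<Rightarrow> complex \<Rightarrow> complex" where
  "local_fun f (Some a) w = f (a + w)"
| "local_fun f None w = f (1 / w)"

text \<open>The coefficient of the form in the local coordinate; at infinity \<open>dz = - dw / w\<^sup>2\<close>.\<close>

fun local_form :: "(complex \<Rightarrow> complex) \<Rightarrow> sphere \<Rightarrow> complex \<Rightarrow> complex" where
  "local_form h (Some a) w = h (a + w)"
| "local_form h None w = - h (1 / w) / w\<^sup>2"

definition meromorphic_function :: "(complex \<Rightarrow> complex) \<Rightarrow> bool" where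
  "meromorphic_function f \<longleftrightarrow> (\<forall>p. local_fun f p meromorphic_on {0})"

definition meromorphic_form :: "(complex \<Rightarrow> complex) \<Rightarrow> bool" where
  "meromorphic_form h \<longleftrightarrow> (\<forall>p. local_form h p meromorphic_on {0})"

definition holomorphic_form_at :: "(complex \<Rightarrow> complex) \<Rightarrow> sphere \<Rightarrow> bool" where
  "holomorphic_form_at h p \<longleftrightarrow> remove_sings (local_form h p) analytic_on {0}"

definition sphere_value :: "(complex \<Rightarrow> complex) \<Rightarrow> sphere \<Rightarrow> sphere" where
  "sphere_value f p =
     (if is_pole (local_fun f p) 0 then None else Some (remove_sings (local_fun f p) 0))"

text \<open>
  Zeros and poles of multiplicity \<open>m > 0\<close> of a germ at 0. The germ must not vanish identically,
  as \<^const>\<open>zorder\<close> is unspecified in that case.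
\<close>

definition zero_of_mult :: "(complex \<Rightarrow> complex) \<Rightarrow> nat \<Rightarrow> bool" where
  "zero_of_mult f m \<longleftrightarrow> m > 0 \<and> (\<exists>\<^sub>F w in at 0. f w \<noteq> 0) \<and> zorder f 0 = int m"

definition pole_of_mult :: "(complex \<Rightarrow> complex) \<Rightarrow> nat \<Rightarrow> bool" where
  "pole_of_mult f m \<longleftrightarrow> m > 0 \<and> (\<exists>\<^sub>F w in at 0. f w \<noteq> 0) \<and> zorder f 0 = - int m"

text \<open>
  Piecewise \<open>C\<^sup>1\<close> curves \<open>[0,1] \<rightarrow> \<Sigma>\<close> on the sphere punctured in \<open>P\<close>; the analogue of
  \<^const>\<open>valid_path\<close>, with differentiability tested in the local coordinate at each point.
\<close>

definition sphere_curve :: "sphere set \<Rightarrow> (real \<Rightarrow> sphere) \<Rightarrow> bool" where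
  "sphere_curve P \<gamma> \<longleftrightarrow>
     pathin (subtopology riemann_sphere (- P)) \<gamma> \<and>
     (\<exists>S. finite S \<and> (\<forall>t \<in> {0..1} - S. \<exists>e>0.
        (\<lambda>s. local_coord (\<gamma> t) (\<gamma> s)) C1_differentiable_on ({0..1} \<inter> ball t e - S)))"

text \<open>
  The integrand is the form at \<open>\<gamma> t\<close> evaluated on the velocity of \<open>\<gamma>\<close>, both expressed in the local
  coordinate at \<open>\<gamma> t\<close>. When \<open>\<gamma>\<close> avoids infinity this is the integrand of the usual contour integral
  of the holomorphic extension of \<open>h\<close>.
\<close>

definition form_integral :: "(complex \<Rightarrow> complex) \<Rightarrow> (real \<Rightarrow> sphere) \<Rightarrow> complex" where
  "form_integral h \<gamma> =
     integral {0..1} (\<lambda>t. remove_sings (local_form h (\<gamma> t)) 0 *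
       vector_derivative (\<lambda>s. local_coord (\<gamma> t) (\<gamma> s)) (at t within {0..1}))"

definition weierstrass_integral ::
  "(complex \<Rightarrow> complex) \<Rightarrow> (complex \<Rightarrow> complex) \<Rightarrow> (real \<Rightarrow> sphere) \<Rightarrow> real ^ 3" where
  "weierstrass_integral G h \<gamma> = vector
     [Re (form_integral (\<lambda>z. 1 / 2 * (1 / G z - G z) * h z) \<gamma>),
      Re (form_integral (\<lambda>z. \<i> / 2 * (1 / G z + G z) * h z) \<gamma>),
      Re (form_integral h \<gamma>)]"

definition period_condition ::
  "(complex \<Rightarrow> complex) \<Rightarrow> (complex \<Rightarrow> complex) \<Rightarrow> sphere set \<Rightarrow> bool" where
  "period_condition G h P \<longleftrightarrow>
     (\<forall>\<gamma>. sphere_curve P \<gamma> \<and> \<gamma> 0 = \<gamma> 1 \<longrightarrow> weierstrass_integral G h \<gamma> = 0)"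

definition regularity_condition ::
  "(complex \<Rightarrow> complex) \<Rightarrow> (complex \<Rightarrow> complex) \<Rightarrow> sphere set \<Rightarrow> bool" where
  "regularity_condition G h P \<longleftrightarrow>
     (\<forall>p \<in> - P. holomorphic_form_at h p \<and>
        (\<forall>m. zero_of_mult (local_fun G p) m \<or> pole_of_mult (local_fun G p) m
               \<longleftrightarrow> zero_of_mult (local_form h p) m))"

definition weierstrass_data ::
  "(complex \<Rightarrow> complex) \<Rightarrow> (complex \<Rightarrow> complex) \<Rightarrow> sphere set \<Rightarrow> bool" where
  "weierstrass_data G h P \<longleftrightarrow>
     finite P \<and> meromorphic_function G \<and> meromorphic_form h \<and>
     (\<forall>p. \<exists>\<^sub>F w in at 0. local_fun G p w \<noteq> 0) \<and>
     (\<forall>p. \<exists>\<^sub>F w in at 0. local_form h p w \<noteq> 0) \<and>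
     period_condition G h P \<and> regularity_condition G h P"

text \<open>Independent of the choice of the curve by the period condition.\<close>

definition weierstrass_map ::
  "(complex \<Rightarrow> complex) \<Rightarrow> (complex \<Rightarrow> complex) \<Rightarrow> sphere set \<Rightarrow> sphere \<Rightarrow> sphere \<Rightarrow> real ^ 3" where
  "weierstrass_map G h P z0 z =
     weierstrass_integral G h (SOME \<gamma>. sphere_curve P \<gamma> \<and> \<gamma> 0 = z0 \<and> \<gamma> 1 = z)"

text \<open>Inverse stereographic projection with 0 the south pole and infinity the north pole.\<close>

fun inv_stereographic :: "sphere \<Rightarrow> real ^ 3" where
  "inv_stereographic None = vector [0, 0, 1]"
| "inv_stereographic (Some g) =
     (1 / ((norm g)\<^sup>2 + 1)) *\<^sub>R vector [2 * Re g, 2 * Im g, (norm g)\<^sup>2 - 1]"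

definition end_normal :: "(complex \<Rightarrow> complex) \<Rightarrow> sphere \<Rightarrow> real ^ 3" where
  "end_normal G p = inv_stereographic (sphere_value G p)"

definition is_vertical :: "real ^ 3 \<Rightarrow> bool" where
  "is_vertical N \<longleftrightarrow> N = vector [0, 0, 1] \<or> N = vector [0, 0, -1]"

text \<open>
  The end of \<open>X\<close> at \<open>p\<close> is embedded and a graph over the exterior of a bounded domain \<open>\<Omega>\<close> of the
  plane orthogonal to the unit vector \<open>N\<close>, with height \<open>c log r + d + O(1/r)\<close>. ``A small punctured
  neighbourhood'' is read as: arbitrarily small ones. Topological embeddings suffice, as \<open>X\<close> is an
  immersion for Weierstrass data.
\<close>

definition graph_end :: "(sphere \<Rightarrow> real ^ 3) \<Rightarrow> sphere \<Rightarrow> real ^ 3 \<Rightarrow> real \<Rightarrow> bool" where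
  "graph_end X p N c \<longleftrightarrow>
     (let plane = {y. y \<bullet> N = 0} in
      \<exists>u :: real ^ 3 \<Rightarrow> real. \<exists>d.
        (\<lambda>y. u y - (c * ln (norm y) + d))
          \<in> O[inf at_infinity (principal plane)](\<lambda>y. 1 / norm y) \<and>
        (\<forall>V. openin riemann_sphere V \<and> p \<in> V \<longrightarrow>
          (\<exists>U K \<Omega>. openin riemann_sphere U \<and> p \<in> U \<and> U \<subseteq> V \<and>
             embedding_map (subtopology riemann_sphere (U - {p})) euclidean X \<and>
             compact K \<and>
             openin (top_of_set plane) \<Omega> \<and> connected \<Omega> \<and> \<Omega> \<noteq> {} \<and> bounded \<Omega> \<and>
             X ` (U - {p}) - K = (\<lambda>y. y + u y *\<^sub>R N) ` (plane - closure \<Omega>))))"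

definition planar_end :: "(complex \<Rightarrow> complex) \<Rightarrow> (sphere \<Rightarrow> real ^ 3) \<Rightarrow> sphere \<Rightarrow> bool" where
  "planar_end G X p \<longleftrightarrow> graph_end X p (end_normal G p) 0"

definition catenoid_end :: "(complex \<Rightarrow> complex) \<Rightarrow> (sphere \<Rightarrow> real ^ 3) \<Rightarrow> sphere \<Rightarrow> bool" where
  "catenoid_end G X p \<longleftrightarrow> (\<exists>c. c \<noteq> 0 \<and> graph_end X p (end_normal G p) c)"

definition points_in_direction ::
  "(complex \<Rightarrow> complex) \<Rightarrow> (sphere \<Rightarrow> real ^ 3) \<Rightarrow> sphere \<Rightarrow> real ^ 3 \<Rightarrow> bool" where
  "points_in_direction G X p \<nu> \<longleftrightarrow>
     \<nu> \<in> {end_normal G p, - end_normal G p} \<and>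
     filterlim (\<lambda>q. X q \<bullet> \<nu>) at_top (atin riemann_sphere p)"

definition upward_pointing ::
  "(complex \<Rightarrow> complex) \<Rightarrow> (sphere \<Rightarrow> real ^ 3) \<Rightarrow> sphere \<Rightarrow> bool" where
  "upward_pointing G X p \<longleftrightarrow> (\<exists>\<nu>. points_in_direction G X p \<nu> \<and> \<nu> $ 3 > 0)"

definition downward_pointing ::
  "(complex \<Rightarrow> complex) \<Rightarrow> (sphere \<Rightarrow> real ^ 3) \<Rightarrow> sphere \<Rightarrow> bool" where
  "downward_pointing G X p \<longleftrightarrow> (\<exists>\<nu>. points_in_direction G X p \<nu> \<and> \<nu> $ 3 < 0)"

end

theory Submission
  imports Defs
begin

text \<open>
  The forms \<open>dh\<close>, \<open>G dh\<close> and \<open>dh / G\<close> are rational and can be integrated by hand. With \<open>u = z ^ k\<close> and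
  \<open>b = a ^ k\<close>, each of them is the derivative of an explicit rational function plus a combination of
  the simple fractions \<open>1 / (z - \<xi>)\<close> with \<open>\<xi>\<close> running through \<open>0\<close> and the \<open>k\<close>-th roots of unity. The
  constant \<open>\<rho>\<close> is chosen so that at every root of unity the residue of \<open>dh / G\<close> is minus the complex
  conjugate of the residue of \<open>G dh\<close>. In the three coordinate forms all coefficients of simple
  fractions are then real, so the three coordinates of the surface have single-valued primitives
  \<open>\<Psi> z = Re (rational) + (\<Sum>\<xi>. c \<xi> * ln \<bar>z - \<xi>\<bar>)\<close>. By the fundamental theorem of calculus the integral along
  any curve is a difference of values of \<open>\<Psi>\<close> (\<open>weierstrass_integral_eq\<close>). This solves the period
  problem and computes the surface up to a translation.

  At a puncture with local coordinate \<open>w\<close> the potential \<open>\<Psi>\<close> gives an expansion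
  \<open>X = Re (C / w) + \<mu> * ln \<bar>w\<bar> * N + Re (F w)\<close> with \<open>F\<close> analytic, \<open>N\<close> the limiting normal, and \<open>C\<close> a complex
  vector whose bilinear square vanishes and which is orthogonal to \<open>N\<close> (locale \<open>null_end\<close>). Because
  \<open>C\<close> is null, its real and imaginary parts are orthogonal and of equal length. The projection of \<open>X\<close> to the plane orthogonal to \<open>N\<close> is
  therefore, in a suitable complex coordinate of this plane, \<open>w \<mapsto> 1 / w + e w\<close> with \<open>e\<close> Lipschitz. Such a map
  is injective near \<open>0\<close> and, by invariance of domain, covers the exterior of a large disc
  (\<open>punctured_inversion_perturbation\<close>). So the end is a graph, and its height is
  \<open>\<mu> * ln \<bar>w\<bar> + Re (F w) \<bullet> N = - \<mu> * ln r + d + O(1 / r)\<close> (\<open>graph_end_of_expansion\<close>).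

  It remains to read off \<open>\<mu>\<close>. At infinity it is \<open>0\<close>: a planar end. At \<open>0\<close> it is \<open>- b\<close>, where \<open>N\<close> points
  down: a catenoid end in the direction \<open>N\<close>. At a root of unity it is positive, and since \<open>\<bar>G\<bar> < 1\<close> there,
  \<open>N\<close> points into the lower half space: a catenoid end in the direction \<open>- N\<close>, that is, upward. That
  the vector of logarithmic coefficients is parallel to \<open>N\<close> at a root of unity is the identity
  \<open>gauss_norm_relation\<close>, a second consequence of the choice of \<open>\<rho>\<close>.
\<close>

section \<open>Charts of the Riemann sphere\<close>

text \<open>
  The inverses of the local coordinates: they parametrize a neighbourhood of \<open>p\<close> by the whole plane,
  with \<open>0\<close> going to \<open>p\<close>, and allow finite punctures and infinity to be treated alike.
\<close>
definition sphere_chart :: "sphere \<Rightarrow> complex \<Rightarrow> sphere" where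
  "sphere_chart p w = (case p of Some a \<Rightarrow> Some (a + w) | None \<Rightarrow> if w = 0 then None else Some (1 / w))"

lemma topspace_riemann_sphere [simp]: "topspace riemann_sphere = UNIV"
  by (auto simp: riemann_sphere_def UNIV_option_conv)

lemma sphere_chart_0 [simp]: "sphere_chart p 0 = p"
  by (simp add: sphere_chart_def split: option.splits)

lemma inj_sphere_chart: "inj_on (sphere_chart p) A"
  by (auto simp: inj_on_def sphere_chart_def split: option.splits if_splits)

lemma open_inverse_preimage:
  fixes W :: "complex set"
  assumes "open W"
  shows "open {z. z \<noteq> 0 \<and> 1 / z \<in> W}"
proof -
  have "open ((- {0}) \<inter> (\<lambda>z. 1 / z) -` W)"
    by (intro continuous_open_preimage assms continuous_intros) auto
  moreover have "(- {0}) \<inter> (\<lambda>z. 1 / z) -` W = {z. z \<noteq> 0 \<and> 1 / z \<in> W}" by auto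
  ultimately show ?thesis by simp
qed

text \<open>
  At infinity the case distinction follows the two kinds of open sets of the compactification. Without
  \<open>0\<close> the inversion of \<open>W\<close> is an open set of the plane; with \<open>0\<close> it has a compact complement, because
  \<open>W\<close> contains a disc around \<open>0\<close>.
\<close>
lemma open_map_sphere_chart: "open_map euclidean riemann_sphere (sphere_chart p)"
proof (cases p)
  case (Some a)
  have "openin riemann_sphere (sphere_chart p ` W)" if "open W" for W
  proof -
    have "sphere_chart p ` W = Some ` ((\<lambda>w. a + w) ` W)"
      by (auto simp: sphere_chart_def Some)
    moreover have "open ((\<lambda>w. a + w) ` W)" by (rule open_translation[OF that])
    ultimately show ?thesis by (simp add: riemann_sphere_def)
  qed
  then show ?thesis by (simp add: open_map_def)
next
  case None
  have "openin riemann_sphere (sphere_chart p ` W)" if W: "open W" for W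
  proof (cases "0 \<in> W")
    case False
    have "sphere_chart p ` W = Some ` {z. z \<noteq> 0 \<and> 1 / z \<in> W}"
    proof (intro equalityI subsetI)
      fix q assume "q \<in> sphere_chart p ` W"
      then obtain w where w: "w \<in> W" "q = sphere_chart p w" by auto
      with False have "w \<noteq> 0" by auto
      with w show "q \<in> Some ` {z. z \<noteq> 0 \<and> 1 / z \<in> W}"
        by (simp add: sphere_chart_def None inj_image_mem_iff)
    next
      fix q assume "q \<in> Some ` {z. z \<noteq> 0 \<and> 1 / z \<in> W}"
      then obtain z where "z \<noteq> 0" "1 / z \<in> W" "q = Some z" by auto
      then show "q \<in> sphere_chart p ` W"
        by (intro image_eqI[of _ _ "1 / z"]) (auto simp: sphere_chart_def None)
    qed
    then show ?thesis using open_inverse_preimage[OF W]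
      by (simp add: riemann_sphere_def)
  next
    case True
    define C where "C = - {z. z \<noteq> 0 \<and> 1 / z \<in> W}"
    obtain e where e: "e > 0" "ball 0 e \<subseteq> W" using W True openE by blast
    have "closed C" using open_inverse_preimage[OF W] by (simp add: C_def closed_def)
    moreover have "norm z \<le> 1 / e" if "z \<in> C" for z
    proof (rule ccontr)
      assume "\<not> norm z \<le> 1 / e"
      then have "norm z > 1 / e" by simp
      moreover have "1 / e > 0" using e by simp
      ultimately have "norm z > 0" by linarith
      then have "norm (1 / z) < e"
        using \<open>norm z > 1 / e\<close> e by (simp add: norm_divide field_simps)
      then have "1 / z \<in> W" using e by (auto simp: ball_def dist_norm norm_minus_commute)
      then show False using that \<open>norm z > 0\<close> by (auto simp: C_def)
    qed
    then have "bounded C" by (auto simp: bounded_iff)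
    ultimately have "compact C" using compact_eq_bounded_closed by blast
    moreover have "sphere_chart p ` W = insert None (Some ` (UNIV - C))"
    proof (intro equalityI subsetI)
      fix q assume "q \<in> sphere_chart p ` W"
      then obtain w where w: "w \<in> W" "q = sphere_chart p w" by auto
      then show "q \<in> insert None (Some ` (UNIV - C))"
        by (cases "w = 0") (simp_all add: sphere_chart_def None C_def inj_image_mem_iff)
    next
      fix q assume "q \<in> insert None (Some ` (UNIV - C))"
      then consider "q = None" | z where "z \<noteq> 0" "1 / z \<in> W" "q = Some z" by (auto simp: C_def)
      then show "q \<in> sphere_chart p ` W"
      proof cases
        case 1
        then show ?thesis using True by (intro image_eqI[of _ _ 0]) (auto simp: None)
      next
        case 2
        then show ?thesis
          by (intro image_eqI[of _ _ "1 / z"]) (auto simp: sphere_chart_def None)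
      qed
    qed
    ultimately show ?thesis using \<open>closed C\<close>
      unfolding riemann_sphere_def openin_Alexandroff_compactification
      by (intro disjI2 exI[of _ C]) simp
  qed
  then show ?thesis by (simp add: open_map_def)
qed

lemma continuous_map_sphere_chart: "continuous_map euclidean riemann_sphere (sphere_chart p)"
proof (cases p)
  case (Some a)
  have "continuous_map euclidean (riemann_sphere) (Some \<circ> (\<lambda>w. a + w))"
    unfolding riemann_sphere_def
    by (rule continuous_map_compose[OF _ continuous_map_Some])
       (auto intro!: continuous_intros)
  moreover have "sphere_chart p = Some \<circ> (\<lambda>w. a + w)"
    by (auto simp: fun_eq_iff sphere_chart_def Some)
  ultimately show ?thesis by simp
next
  case None
  have "open (sphere_chart p -` V)" if V: "openin riemann_sphere V" for V
  proof -
    from V consider U where "open U" "V = Some ` U" | C where "compact C" "V = insert None (Some ` (- C))"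
      unfolding riemann_sphere_def openin_Alexandroff_compactification
      by (auto simp: Compl_eq_Diff_UNIV)
    then show ?thesis
    proof cases
      case 1
      then have "sphere_chart p -` V = {z. z \<noteq> 0 \<and> 1 / z \<in> U}"
        by (auto simp: sphere_chart_def None split: if_splits)
      then show ?thesis using open_inverse_preimage[OF 1(1)] by simp
    next
      case 2
      from \<open>compact C\<close> obtain B where B: "B > 0" "\<And>z. z \<in> C \<Longrightarrow> norm z \<le> B"
        using compact_imp_bounded bounded_pos by metis
      have in_ball: "1 / z \<notin> C" if "z \<in> ball 0 (1 / B)" "z \<noteq> 0" for z
      proof
        assume "1 / z \<in> C"
        then have "norm (1 / z) \<le> B" by (rule B)
        then show False using that B by (simp add: norm_divide field_simps)
      qed
      have "z \<in> sphere_chart p -` V \<longleftrightarrow> z \<in> ball 0 (1 / B) \<union> {z. z \<noteq> 0 \<and> 1 / z \<in> - C}" for z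
        using in_ball[of z] B(1) by (cases "z = 0") (auto simp: 2 sphere_chart_def None inj_image_mem_iff)
      then have "sphere_chart p -` V = ball 0 (1 / B) \<union> {z. z \<noteq> 0 \<and> 1 / z \<in> - C}" by blast
      moreover have "open {z. z \<noteq> 0 \<and> 1 / z \<in> - C}"
        by (rule open_inverse_preimage) (use 2 compact_imp_closed in auto)
      ultimately show ?thesis by auto
    qed
  qed
  then show ?thesis
    by (simp add: continuous_map vimage_def Pi_iff)
qed

lemma embedding_map_sphere_chart: "embedding_map euclidean riemann_sphere (sphere_chart p)"
  by (intro injective_open_imp_embedding_map continuous_map_sphere_chart open_map_sphere_chart inj_sphere_chart)

lemma eventually_atin_sphere_chart:
  assumes "eventually (\<lambda>w. P (sphere_chart p w)) (at 0)"
  shows "eventually P (atin riemann_sphere p)"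
proof -
  obtain W where W: "open W" "0 \<in> W" "\<And>w. w \<in> W \<Longrightarrow> w \<noteq> 0 \<Longrightarrow> P (sphere_chart p w)"
    using assms by (auto simp: eventually_at_topological)
  have "openin riemann_sphere (sphere_chart p ` W)"
    using W open_map_sphere_chart by (auto simp: open_map_def)
  moreover have "p \<in> sphere_chart p ` W" using W by (metis sphere_chart_0 image_eqI)
  moreover have "\<forall>x\<in>sphere_chart p ` W - {p}. P x" using W by force
  ultimately show ?thesis unfolding eventually_atin by blast
qed

section \<open>Perturbations of the inversion\<close>

lemma abs_ln_le_twice_diff:
  fixes x :: real
  assumes "\<bar>x - 1\<bar> \<le> 1 / 2"
  shows "\<bar>ln x\<bar> \<le> 2 * \<bar>x - 1\<bar>"
proof -
  have x: "x \<ge> 1 / 2" using assms by linarith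
  have "ln x \<le> x - 1" using x ln_le_minus_one[of x] by linarith
  moreover have "ln (1 / x) \<le> 1 / x - 1" using x by (intro ln_le_minus_one) auto
  then have "- ln x \<le> 1 / x - 1" using x by (simp add: ln_div)
  moreover have "1 / x - 1 \<le> 2 * \<bar>x - 1\<bar>"
  proof -
    have "1 / x - 1 = (1 - x) * (1 / x)" using x by (simp add: field_simps)
    also have "\<dots> \<le> \<bar>1 - x\<bar> * 2"
      by (intro mult_mono) (use x in \<open>auto simp: field_simps\<close>)
    finally show ?thesis by (simp add: abs_minus_commute)
  qed
  moreover have "x - 1 \<le> 2 * \<bar>x - 1\<bar>" by (simp add: abs_if)
  ultimately show ?thesis unfolding abs_le_iff by (meson order_trans)
qed

text \<open>
  The reciprocal \<open>H w = w / (1 + w * e w)\<close> of \<open>f\<close> extends continuously by \<open>0\<close> to the origin. Injectivity of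
  \<open>f\<close> holds because \<open>1 / x - 1 / y\<close> exceeds any Lipschitz difference when \<open>x\<close> and \<open>y\<close> are small. So \<open>H\<close>
  is injective near \<open>0\<close>, its images of small discs are open by invariance of domain, and preimages
  of discs under \<open>H\<close> are the sets on which \<open>f\<close> runs through the exterior of a disc exactly once.
  The bounds on \<open>w * f w\<close> compare \<open>\<bar>f w\<bar>\<close> with \<open>1 / \<bar>w\<bar>\<close>.
\<close>
lemma punctured_inversion_perturbation:
  fixes e :: "complex \<Rightarrow> complex"
  assumes lip: "M-lipschitz_on (ball 0 \<epsilon>) e" and "\<epsilon> > 0"
  defines "f \<equiv> \<lambda>w. 1 / w + e w"
  obtains \<delta> K where "0 < \<delta>" "\<delta> \<le> \<epsilon>" "K > 0" "inj_on f (ball 0 \<delta> - {0})"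
    "\<And>w. w \<in> ball 0 \<delta> \<Longrightarrow> norm (w * f w - 1) \<le> K * norm w \<or> w = 0"
    "\<And>w :: complex. w \<in> ball 0 \<delta> \<Longrightarrow> K * norm w \<le> 1 / 2"
    "\<And>\<eta>. 0 < \<eta> \<Longrightarrow> \<eta> \<le> \<delta> \<Longrightarrow>
      \<exists>R>0. \<exists>W. open W \<and> 0 \<in> W \<and> W \<subseteq> ball 0 \<eta> \<and> f ` (W - {0}) = {v. norm v > R}"
proof -
  have M: "M \<ge> 0" using lip lipschitz_on_nonneg by blast
  define K where "K = norm (e 0) + M * \<epsilon> + 1"
  \<comment> \<open>\<open>K\<close> bounds \<open>e\<close>, so the bound \<open>1 / (2 * K)\<close> keeps \<open>w * e w\<close> below \<open>1 / 2\<close>; the bounds \<open>1\<close> and \<open>1 / (M + 1)\<close>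
      make \<open>M * \<bar>x\<bar> * \<bar>y\<bar> < 1\<close>, which gives injectivity.\<close>
  define \<delta> where "\<delta> = min (min \<epsilon> 1) (min (1 / (2 * K)) (1 / (M + 1)))"
  have K: "K > 0" "K \<ge> 1" using M \<open>\<epsilon> > 0\<close> by (auto simp: K_def add_nonneg_pos)
  have \<delta>: "\<delta> > 0" "\<delta> \<le> \<epsilon>" "\<delta> \<le> 1" "\<delta> \<le> 1 / (2 * K)" "\<delta> \<le> 1 / (M + 1)"
    using K M \<open>\<epsilon> > 0\<close> unfolding \<delta>_def by auto
  have eK: "norm (e w) \<le> K" if "w \<in> ball 0 \<delta>" for w
  proof -
    have "dist (e w) (e 0) \<le> M * dist w 0"
      using that \<delta> \<open>\<epsilon> > 0\<close> by (intro lipschitz_onD[OF lip]) auto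
    also have "\<dots> \<le> M * \<epsilon>" using that \<delta> M by (intro mult_left_mono) auto
    finally have "norm (e w - e 0) \<le> M * \<epsilon>" by (simp add: dist_norm)
    moreover have "norm (e w) \<le> norm (e w - e 0) + norm (e 0)" by norm
    ultimately show ?thesis by (simp add: K_def)
  qed
  have Kw: "K * norm w \<le> 1 / 2" if "w \<in> ball 0 \<delta>" for w :: complex
  proof -
    have "K * norm w \<le> K * (1 / (2 * K))" using that \<delta> K by (intro mult_left_mono) auto
    then show ?thesis using K by simp
  qed
  have eq: "w * f w - 1 = w * e w" if "w \<noteq> 0" for w
    using that by (simp add: f_def field_simps)
  have bound: "norm (w * e w) \<le> K * norm w" if "w \<in> ball 0 \<delta>" for w
    using eK[OF that] by (simp add: norm_mult mult.commute[of K] mult_left_mono)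
  have nz: "1 + w * e w \<noteq> 0" if "w \<in> ball 0 \<delta>" for w
  proof
    assume "1 + w * e w = 0"
    then have "norm (w * e w) = 1" by (metis add_eq_0_iff norm_minus_cancel norm_one)
    then show False using bound[OF that] Kw[OF that] by simp
  qed
  have inj: "inj_on f (ball 0 \<delta> - {0})"
  proof (rule inj_onI)
    fix x y assume xy: "x \<in> ball 0 \<delta> - {0}" "y \<in> ball 0 \<delta> - {0}" "f x = f y"
    have "1 / x - 1 / y = e y - e x" using xy(3) by (simp add: f_def algebra_simps)
    moreover have "1 / x - 1 / y = (y - x) / (x * y)" using xy by (simp add: field_simps)
    ultimately have "y - x = (e y - e x) * (x * y)" using xy by (simp add: field_simps)
    then have "norm (y - x) = norm (e y - e x) * (norm x * norm y)" by (simp add: norm_mult)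
    also have "\<dots> \<le> (M * norm (y - x)) * (norm x * norm y)"
      using lipschitz_onD[OF lip, of y x] xy \<delta>
      by (intro mult_right_mono) (auto simp: dist_norm)
    also have "\<dots> = norm (y - x) * (M * norm x * norm y)" by simp
    finally have 1: "norm (y - x) \<le> norm (y - x) * (M * norm x * norm y)" .
    have "M * norm x * norm y \<le> M * (1 / (M + 1)) * 1"
      using xy \<delta> M by (intro mult_mono) auto
    also have "\<dots> < 1" using M by (simp add: field_simps)
    finally have "M * norm x * norm y < 1" .
    then have "norm (y - x) = 0"
      using 1 by (metis mult.right_neutral mult_less_cancel_left_pos norm_ge_zero not_le order_le_less)
    then show "x = y" by simp
  qed
  define H where "H w = w / (1 + w * e w)" for w
  have Hf: "H w = 1 / f w" if "w \<in> ball 0 \<delta>" "w \<noteq> 0" for w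
    using nz[OF that(1)] that(2) by (simp add: H_def f_def field_simps)
  have H0: "H w = 0 \<longleftrightarrow> w = 0" if "w \<in> ball 0 \<delta>" for w
    using nz[OF that] by (simp add: H_def)
  have contH: "continuous_on (ball 0 \<delta>) H"
    unfolding H_def
    by (intro continuous_intros continuous_on_subset[OF lipschitz_on_continuous_on[OF lip]])
       (use nz \<delta> in auto)
  have injH: "inj_on H (ball 0 \<delta>)"
  proof (rule inj_onI)
    fix x y assume xy: "x \<in> ball 0 \<delta>" "y \<in> ball 0 \<delta>" "H x = H y"
    show "x = y"
    proof (cases "x = 0 \<or> y = 0")
      case True
      then show ?thesis using H0 xy by metis
    next
      case False
      then have "f x = f y" using xy Hf by (metis nonzero_eq_divide_eq divide_eq_0_iff inverse_eq_divide inverse_eq_iff_eq)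
      then show ?thesis using inj xy False by (auto simp: inj_on_def)
    qed
  qed
  have "\<exists>R>0. \<exists>W. open W \<and> 0 \<in> W \<and> W \<subseteq> ball 0 \<eta> \<and> f ` (W - {0}) = {v. norm v > R}"
    if \<eta>: "0 < \<eta>" "\<eta> \<le> \<delta>" for \<eta>
  proof -
    have sub: "ball 0 \<eta> \<subseteq> ball (0::complex) \<delta>" using \<eta> by auto
    have "open (H ` ball 0 \<eta>)"
      using invariance_of_domain_gen[OF open_ball continuous_on_subset[OF contH sub] inj_on_subset[OF injH sub]]
      by simp
    moreover have "0 \<in> H ` ball 0 \<eta>" using \<eta> by (intro image_eqI[of _ _ 0]) (auto simp: H_def)
    ultimately obtain r where r: "r > 0" "ball 0 r \<subseteq> H ` ball 0 \<eta>" using openE by blast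
    define W where "W = ball 0 \<eta> \<inter> H -` ball 0 r"
    have "open W" unfolding W_def
      by (intro continuous_open_preimage continuous_on_subset[OF contH sub]) auto
    moreover have "0 \<in> W" using \<eta> r by (auto simp: W_def H_def)
    moreover have "f ` (W - {0}) = {v :: complex. norm v > 1 / r}"
    proof (intro equalityI subsetI)
      fix v assume "v \<in> f ` (W - {0})"
      then obtain w where w: "w \<in> W" "w \<noteq> 0" "v = f w" by auto
      then have wd: "w \<in> ball 0 \<delta>" using sub by (auto simp: W_def)
      have "norm (H w) < r" using w by (auto simp: W_def)
      moreover have "H w \<noteq> 0" using H0[OF wd] w by simp
      ultimately have "norm (1 / v) < r" "v \<noteq> 0" using Hf[OF wd] w by auto
      then show "v \<in> {v :: complex. norm v > 1 / r}" using r by (simp add: norm_divide field_simps)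
    next
      fix v assume "v \<in> {v :: complex. norm v > 1 / r}"
      then have v: "norm v > 1 / r" by simp
      moreover have "1 / r > 0" using r by simp
      ultimately have "norm v > 0" by linarith
      then have v0: "v \<noteq> 0" and "norm (1 / v) < r" using v r by (auto simp: norm_divide field_simps)
      then obtain w where w: "w \<in> ball 0 \<eta>" "1 / v = H w" using r by (auto simp: subset_iff image_iff)
      then have wd: "w \<in> ball 0 \<delta>" using sub by auto
      have "w \<noteq> 0" using w v0 by (auto simp: H_def)
      then have "v = f w" using w(2) Hf[OF wd] v0 by (metis inverse_eq_divide inverse_inverse_eq)
      moreover have "w \<in> W" using w \<open>norm (1 / v) < r\<close> by (auto simp: W_def)
      ultimately show "v \<in> f ` (W - {0})" using \<open>w \<noteq> 0\<close> by auto
    qed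
    ultimately show ?thesis using r by (intro exI[of _ "1 / r"]) (auto simp: W_def)
  qed
  then show thesis
    using that[OF \<delta>(1,2) K(1) inj _ Kw] bound eq by metis
qed

section \<open>Graphical ends\<close>

lemma embedding_map_of_homeomorphic_reparametrization:
  assumes "homeomorphic_map A B c" "embedding_map A C (f \<circ> c)"
  shows "embedding_map B C f"
proof -
  obtain d where d: "homeomorphic_maps A B c d" using assms(1) homeomorphic_map_maps by blast
  then have "homeomorphic_map B A d" by (simp add: homeomorphic_maps_map)
  then have "embedding_map B A d"
    by (simp add: embedding_map_def homeomorphic_imp_surjective_map)
  then have "embedding_map B C ((f \<circ> c) \<circ> d)" using assms(2) embedding_map_compose by blast
  moreover have "((f \<circ> c) \<circ> d) x = f x" if "x \<in> topspace B" for x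
    using d that by (simp add: homeomorphic_maps_def)
  ultimately show ?thesis using embedding_map_eq by blast
qed

lemma homeomorphic_map_sphere_chart:
  "homeomorphic_map (top_of_set S) (subtopology riemann_sphere (sphere_chart p ` S)) (sphere_chart p)"
proof -
  have "homeomorphic_map (subtopology euclidean S)
      (subtopology (subtopology riemann_sphere (sphere_chart p ` topspace euclidean)) (sphere_chart p ` S)) (sphere_chart p)"
    using embedding_map_sphere_chart[of p] unfolding embedding_map_def
    by (rule homeomorphic_map_subtopologies) auto
  then show ?thesis by (simp add: subtopology_subtopology Int_absorb1 image_mono)
qed

lemma homeomorphism_imp_embedding_map:
  assumes "homeomorphism S T f g"
  shows "embedding_map (top_of_set S) euclidean f"
proof -
  have "homeomorphic_maps (top_of_set S) (top_of_set (f ` S)) f g"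
    using assms unfolding homeomorphism_def homeomorphic_maps_def by auto
  then have "homeomorphic_map (top_of_set S) (top_of_set (f ` S)) f" by (simp add: homeomorphic_maps_map)
  then show ?thesis by (simp add: embedding_map_def)
qed

text \<open>
  If \<open>C = p + \<i> q\<close>, then \<open>planar_frame p q v\<close> is the real part of \<open>v * C\<close>.
\<close>
definition planar_frame :: "real ^ 3 \<Rightarrow> real ^ 3 \<Rightarrow> complex \<Rightarrow> real ^ 3" where
  "planar_frame p q v = Re v *\<^sub>R p - Im v *\<^sub>R q"

text \<open>
  The remainder is orthogonal to \<open>p\<close>, \<open>q\<close> and \<open>N\<close>; were it nonzero, there would be four pairwise
  orthogonal nonzero vectors in three-space.
\<close>
lemma orthogonal_complement_of_normal:
  fixes p q N y :: "real ^ 3"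
  assumes "p \<noteq> 0" "q \<noteq> 0" "norm N = 1" "p \<bullet> q = 0" "p \<bullet> N = 0" "q \<bullet> N = 0" "y \<bullet> N = 0"
  shows "y = ((y \<bullet> p) / (p \<bullet> p)) *\<^sub>R p + ((y \<bullet> q) / (q \<bullet> q)) *\<^sub>R q"
proof -
  define z where "z = y - ((y \<bullet> p) / (p \<bullet> p)) *\<^sub>R p - ((y \<bullet> q) / (q \<bullet> q)) *\<^sub>R q"
  have N: "N \<noteq> 0" using assms(3) by auto
  have orth: "z \<bullet> p = 0" "z \<bullet> q = 0" "z \<bullet> N = 0"
    using assms by (auto simp: z_def inner_diff_left inner_diff_right inner_commute)
  have "z = 0"
  proof (rule ccontr)
    assume "z \<noteq> 0"
    define B where "B = {z, p, q, N}"
    have "p \<bullet> z = 0" "q \<bullet> z = 0" "N \<bullet> z = 0" "q \<bullet> p = 0" "N \<bullet> p = 0" "N \<bullet> q = 0"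
      using orth assms(4-6) by (simp_all add: inner_commute)
    then have "pairwise orthogonal B" using orth assms(4-6)
      by (auto simp: B_def pairwise_insert orthogonal_def)
    moreover have "0 \<notin> B" using assms N \<open>z \<noteq> 0\<close> by (auto simp: B_def)
    ultimately have "independent B" by (rule pairwise_orthogonal_independent)
    then have "card B \<le> DIM(real ^ 3)" using independent_bound by blast
    moreover have "card B = 4"
    proof -
      have "z \<noteq> p" "z \<noteq> q" "z \<noteq> N" using orth \<open>z \<noteq> 0\<close> by auto
      moreover have "p \<noteq> q" "p \<noteq> N" "q \<noteq> N" using assms N by auto
      ultimately show ?thesis by (simp add: B_def)
    qed
    ultimately show False by simp
  qed
  then show ?thesis by (simp add: z_def algebra_simps)
qed

text \<open>
  The geometric content of a null vector \<open>p + \<i> q\<close> orthogonal to \<open>N\<close>: up to the factor \<open>norm p\<close> the map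
  \<^const>\<open>planar_frame\<close> is an isometry from the complex plane onto the plane orthogonal to \<open>N\<close>.
\<close>
locale end_frame =
  fixes p q N :: "real ^ 3"
  assumes norm_N: "norm N = 1" and pq: "p \<bullet> q = 0" and norm_pq: "norm p = norm q" and p0: "p \<noteq> 0"
    and pN: "p \<bullet> N = 0" and qN: "q \<bullet> N = 0"
begin

lemma q0: "q \<noteq> 0" using p0 norm_pq by auto

abbreviation "\<Phi> \<equiv> planar_frame p q"

text \<open>
  Orthogonal projection along \<open>N\<close>, followed by the inverse of the frame.
\<close>
definition coord :: "real ^ 3 \<Rightarrow> complex" where
  "coord y = Complex ((y \<bullet> p) / (p \<bullet> p)) (- ((y \<bullet> q) / (q \<bullet> q)))"

lemma frame_N [simp]: "\<Phi> v \<bullet> N = 0"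
  by (simp add: planar_frame_def inner_diff_left pN qN)

lemma N_N [simp]: "N \<bullet> N = 1"
  using norm_N by (simp add: norm_eq_1)

lemma coord_frame [simp]: "coord (\<Phi> v) = v"
  using p0 q0 by (simp add: coord_def planar_frame_def inner_diff_left pq inner_commute[of q p] complex_eq_iff)

lemma coord_N [simp]: "coord N = 0"
  by (simp add: coord_def inner_commute[of N] pN qN complex_eq_iff)

lemma coord_add: "coord (x + y) = coord x + coord y"
  by (simp add: coord_def inner_add_left complex_eq_iff add_divide_distrib)

lemma coord_scaleR: "coord (c *\<^sub>R x) = c *\<^sub>R coord x"
  by (simp add: coord_def complex_eq_iff)

lemma frame_coord: "y \<bullet> N = 0 \<Longrightarrow> \<Phi> (coord y) = y"
  using orthogonal_complement_of_normal[OF p0 q0 norm_N pq pN qN, of y]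
  by (simp add: coord_def planar_frame_def)

lemma frame_coord_general: "\<Phi> (coord y) + (y \<bullet> N) *\<^sub>R N = y"
proof -
  have "(y - (y \<bullet> N) *\<^sub>R N) \<bullet> N = 0" by (simp add: inner_diff_left)
  from frame_coord[OF this] have "\<Phi> (coord (y + (- (y \<bullet> N)) *\<^sub>R N)) = y - (y \<bullet> N) *\<^sub>R N" by simp
  then show ?thesis by (simp only: coord_add coord_scaleR coord_N) simp
qed

lemma linear_frame: "linear \<Phi>"
  by (rule linearI) (simp_all add: planar_frame_def algebra_simps)

lemma linear_coord: "linear coord"
  by (rule linearI) (simp_all add: coord_add coord_scaleR)

lemma norm_frame: "norm (\<Phi> v) = norm p * norm v"
proof -
  have "(norm (\<Phi> v))\<^sup>2 = (Re v)\<^sup>2 * (norm p)\<^sup>2 + (Im v)\<^sup>2 * (norm q)\<^sup>2"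
    unfolding power2_norm_eq_inner
    by (simp add: planar_frame_def inner_diff_left inner_diff_right pq inner_commute[of q p] power2_eq_square)
  also have "\<dots> = (norm p * norm v)\<^sup>2"
    by (simp add: norm_pq power_mult_distrib cmod_power2 algebra_simps)
  finally show ?thesis by (simp add: power2_eq_iff_nonneg)
qed

lemma inj_frame: "inj \<Phi>"
  by (rule inj_on_inverseI[of _ coord]) simp

lemma range_frame: "range \<Phi> = {y. y \<bullet> N = 0}"
proof (intro equalityI subsetI)
  fix y assume "y \<in> {y. y \<bullet> N = 0}"
  then show "y \<in> range \<Phi>" using frame_coord[of y, symmetric] by blast
qed auto

lemma plane_minus_closure_disc:
  assumes "R > 0"
  shows "{y. y \<bullet> N = 0} - closure (\<Phi> ` ball 0 R) = \<Phi> ` {v. norm v > R}"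
proof -
  have "closure (\<Phi> ` ball 0 R) = \<Phi> ` cball 0 R"
    using closure_injective_linear_image[OF linear_frame inj_frame, of "ball 0 R"] assms by simp
  then have "{y. y \<bullet> N = 0} - closure (\<Phi> ` ball 0 R) = \<Phi> ` (UNIV - cball 0 R)"
    unfolding range_frame[symmetric] image_set_diff[OF inj_frame] by simp
  moreover have "UNIV - cball 0 R = {v::complex. norm v > R}" by auto
  ultimately show ?thesis by simp
qed

lemma openin_frame_disc: "openin (top_of_set {y. y \<bullet> N = 0}) (\<Phi> ` ball 0 R)"
proof -
  have "\<Phi> ` ball 0 R = {y. y \<bullet> N = 0} \<inter> coord -` ball 0 R"
  proof (intro equalityI subsetI)
    fix y assume "y \<in> {y. y \<bullet> N = 0} \<inter> coord -` ball 0 R"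
    then have "y = \<Phi> (coord y)" "coord y \<in> ball 0 R" by (simp_all add: frame_coord)
    then show "y \<in> \<Phi> ` ball 0 R" by blast
  qed auto
  moreover have "continuous_on UNIV coord"
    using linear_coord linear_conv_bounded_linear linear_continuous_on by blast
  then have "open (coord -` ball 0 R)" by (intro open_vimage) auto
  ultimately show ?thesis by (metis openin_open_Int)
qed

end

lemma analytic_imp_lipschitz_near_0:
  assumes "f analytic_on {0}"
  shows "\<exists>\<epsilon>>0. \<exists>M. M-lipschitz_on (ball 0 \<epsilon>) f"
proof -
  obtain r where r: "r > 0" "f holomorphic_on ball 0 r"
    using assms by (auto simp: analytic_on_def)
  have sub: "cball 0 (r / 2) \<subseteq> ball 0 r" using r by auto
  have "deriv f holomorphic_on ball 0 r" using r by (intro holomorphic_deriv) auto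
  then have "continuous_on (cball 0 (r / 2)) (deriv f)"
    using sub holomorphic_on_imp_continuous_on continuous_on_subset by blast
  then have "bounded (deriv f ` cball 0 (r / 2))"
    using compact_continuous_image compact_imp_bounded compact_cball by blast
  then obtain B where "\<forall>y\<in>deriv f ` cball 0 (r / 2). norm y \<le> B" unfolding bounded_iff by blast
  then have B: "norm (deriv f z) \<le> B" if "z \<in> cball 0 (r / 2)" for z using that by blast
  have "norm (deriv f 0) \<le> B" using r by (intro B) auto
  then have "B \<ge> 0" using norm_ge_zero[of "deriv f 0"] by linarith
  have "norm (f x - f y) \<le> B * norm (x - y)" if "x \<in> ball 0 (r / 2)" "y \<in> ball 0 (r / 2)" for x y
  proof (rule field_differentiable_bound[OF convex_ball _ _ that])
    fix z assume "z \<in> ball (0::complex) (r / 2)"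
    then have "z \<in> ball 0 r" "z \<in> cball 0 (r / 2)" using r by auto
    then show "norm (deriv f z) \<le> B" "(f has_field_derivative deriv f z) (at z within ball 0 (r / 2))"
      using B r holomorphic_derivI[OF r(2) open_ball] has_field_derivative_at_within by blast+
  qed
  then have "B-lipschitz_on (ball 0 (r / 2)) f"
    using \<open>B \<ge> 0\<close> by (intro lipschitz_onI) (auto simp: dist_norm)
  then show ?thesis using r by (intro exI[of _ "r / 2"]) auto
qed

lemma analytic_vector_lipschitz_near_0:
  fixes F :: "'n::finite \<Rightarrow> complex \<Rightarrow> complex"
  assumes "\<And>j. F j analytic_on {0}"
  shows "\<exists>\<epsilon>>0. \<exists>M. M-lipschitz_on (ball 0 \<epsilon>) (\<lambda>w. \<chi> j. Re (F j w))"
proof -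
  have "\<forall>j. \<exists>\<epsilon>>0. \<exists>M. M-lipschitz_on (ball 0 \<epsilon>) (F j)"
    using analytic_imp_lipschitz_near_0[OF assms] by blast
  then obtain \<epsilon> M where *: "\<And>j. \<epsilon> j > 0" "\<And>j. (M j)-lipschitz_on (ball 0 (\<epsilon> j)) (F j)" by metis
  define r where "r = Min (range \<epsilon>)"
  have r: "r > 0" "\<And>j. r \<le> \<epsilon> j" using *(1) by (auto simp: r_def)
  have "(\<Sum>j\<in>UNIV. M j)-lipschitz_on (ball 0 r) (\<lambda>w. \<chi> j. Re (F j w))"
  proof (rule lipschitz_onI)
    fix x y :: complex assume xy: "x \<in> ball 0 r" "y \<in> ball 0 r"
    have "\<bar>Re (F j x) - Re (F j y)\<bar> \<le> M j * dist x y" for j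
    proof -
      have "\<bar>Re (F j x - F j y)\<bar> \<le> dist (F j x) (F j y)" unfolding dist_norm by (rule abs_Re_le_cmod)
      also have "\<dots> \<le> M j * dist x y" using xy r(2)[of j] by (intro lipschitz_onD[OF *(2)]) auto
      finally show ?thesis by simp
    qed
    then have "(\<Sum>j\<in>UNIV. \<bar>Re (F j x) - Re (F j y)\<bar>) \<le> (\<Sum>j\<in>UNIV. M j) * dist x y"
      by (simp add: sum_distrib_right sum_mono)
    moreover have "dist (\<chi> j. Re (F j x)) (\<chi> j. Re (F j y)) \<le> (\<Sum>j\<in>UNIV. \<bar>Re (F j x) - Re (F j y)\<bar>)"
      unfolding dist_norm by (rule order_trans[OF norm_le_l1_cart]) simp
    ultimately show "dist (\<chi> j. Re (F j x)) (\<chi> j. Re (F j y)) \<le> (\<Sum>j\<in>UNIV. M j) * dist x y" by linarith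
  next
    show "0 \<le> (\<Sum>j\<in>UNIV. M j)" using *(2) lipschitz_on_nonneg by (intro sum_nonneg) blast
  qed
  then show ?thesis using r by blast
qed

context end_frame begin

text \<open>
  In the complex coordinate of the plane, the projection of \<open>X\<close> is \<open>f w = 1 / w + coord (E w)\<close>: the
  logarithmic term has the direction \<open>N\<close> and disappears. Thus \<open>X\<close> is the graph of the height \<open>hgt\<close>
  over the injective map \<open>f\<close>, it is an embedding because \<open>f\<close> has a continuous inverse, and
  \<open>ln \<bar>w\<bar> = - ln \<bar>f w\<bar> + O(\<bar>w\<bar>)\<close> turns the expansion in \<open>w\<close> into the expansion in the distance \<open>r\<close>. Neighbourhoods on which \<open>f\<close>
  is onto the exterior of a disc make the graph exact, so the exceptional compact set is empty.
\<close>
lemma graph_end_of_expansion: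
  fixes F :: "3 \<Rightarrow> complex \<Rightarrow> complex" and X :: "sphere \<Rightarrow> real ^ 3" and \<mu> :: real
  assumes F: "\<And>j. F j analytic_on {0}"
    and expansion: "\<forall>\<^sub>F w in at 0. X (sphere_chart P w) =
      \<Phi> (1 / w) + (\<mu> * ln (norm w)) *\<^sub>R N + (\<chi> j. Re (F j w))"
  shows "graph_end X P N (- \<mu>)"
proof -
  define E :: "complex \<Rightarrow> real ^ 3" where "E w = (\<chi> j. Re (F j w))" for w
  have "E = (\<lambda>w. \<chi> j. Re (F j w))" by (simp add: E_def fun_eq_iff)
  then have "\<exists>\<epsilon>>0. \<exists>M. M-lipschitz_on (ball 0 \<epsilon>) E"
    using analytic_vector_lipschitz_near_0[of F, OF F] by simp
  then obtain \<epsilon>1 M where \<epsilon>1: "\<epsilon>1 > 0" "M-lipschitz_on (ball 0 \<epsilon>1) E" by blast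
  obtain \<epsilon>2 where \<epsilon>2: "\<epsilon>2 > 0" "\<And>w. w \<noteq> 0 \<Longrightarrow> norm w < \<epsilon>2 \<Longrightarrow>
      X (sphere_chart P w) = \<Phi> (1 / w) + (\<mu> * ln (norm w)) *\<^sub>R N + E w"
    using expansion unfolding eventually_at E_def[symmetric] by (auto simp: dist_norm)
  define \<epsilon> where "\<epsilon> = min \<epsilon>1 \<epsilon>2"
  have \<epsilon>: "\<epsilon> > 0" using \<epsilon>1 \<epsilon>2 by (simp add: \<epsilon>_def)
  have lipE: "M-lipschitz_on (ball 0 \<epsilon>) E"
    by (rule lipschitz_on_subset[OF \<epsilon>1(2)]) (auto simp: \<epsilon>_def)
  have "M \<ge> 0" using lipE lipschitz_on_nonneg by blast
  have bl: "bounded_linear coord" using linear_coord linear_conv_bounded_linear by blast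
  then obtain B where B: "B-lipschitz_on UNIV coord"
    using bounded_linear.lipschitz_boundE by blast
  have lipe: "(B * M)-lipschitz_on (ball 0 \<epsilon>) (\<lambda>w. coord (E w))"
    by (rule lipschitz_on_compose2[OF lipE lipschitz_on_subset[OF B subset_UNIV]])
  obtain \<delta> K where \<delta>: "0 < \<delta>" "\<delta> \<le> \<epsilon>" "K > 0"
      and inj: "inj_on (\<lambda>w. 1 / w + coord (E w)) (ball 0 \<delta> - {0})"
      and K: "\<And>w. w \<in> ball 0 \<delta> \<Longrightarrow> norm (w * (1 / w + coord (E w)) - 1) \<le> K * norm w \<or> w = 0"
        "\<And>w :: complex. w \<in> ball 0 \<delta> \<Longrightarrow> K * norm w \<le> 1 / 2"
      and nbhds: "\<And>\<eta>. 0 < \<eta> \<Longrightarrow> \<eta> \<le> \<delta> \<Longrightarrow> \<exists>R>0. \<exists>W. open W \<and> 0 \<in> W \<and> W \<subseteq> ball 0 \<eta> \<and>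
          (\<lambda>w. 1 / w + coord (E w)) ` (W - {0}) = {v. norm v > R}"
    by (rule punctured_inversion_perturbation[OF lipe \<epsilon>]) (rule that; assumption)
  define f where "f w = 1 / w + coord (E w)" for w
  define D where "D = ball (0::complex) \<delta> - {0}"
  have injf: "inj_on f D" using inj unfolding f_def[abs_def] D_def .
  define hgt where "hgt w = \<mu> * ln (norm w) + E w \<bullet> N" for w
  define finv where "finv = inv_into D f"
  have finv: "finv (f w) = w" if "w \<in> D" for w using inv_into_f_f[OF injf that] by (simp add: finv_def)
  have X: "X (sphere_chart P w) = \<Phi> (f w) + hgt w *\<^sub>R N" if "w \<in> D" for w
  proof -
    have "X (sphere_chart P w) = \<Phi> (1 / w) + (\<mu> * ln (norm w)) *\<^sub>R N + E w"
      using that \<delta> by (intro \<epsilon>2(2)) (auto simp: D_def \<epsilon>_def)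
    also have "E w = \<Phi> (coord (E w)) + (E w \<bullet> N) *\<^sub>R N" by (simp add: frame_coord_general)
    finally show ?thesis
      by (simp add: f_def hgt_def linear_add[OF linear_frame] algebra_simps)
  qed
  have coordX: "coord (X (sphere_chart P w)) = f w" if "w \<in> D" for w
    by (simp add: X[OF that] coord_add coord_scaleR)
  define u where "u y = hgt (finv (coord y))" for y
  \<comment> \<open>The frame scales lengths by \<open>norm p\<close>, so \<open>ln r = ln (norm p) + ln \<bar>f w\<bar>\<close>.\<close>
  define d where "d = \<mu> * ln (norm p) + E 0 \<bullet> N"
  have contE: "continuous_on D E"
    by (rule continuous_on_subset[OF lipschitz_on_continuous_on[OF lipE]]) (use \<delta> in \<open>auto simp: D_def\<close>)
  have cont_coord: "continuous_on A coord" for A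
    using bl linear_continuous_on by blast
  have contf: "continuous_on D f" unfolding f_def[abs_def]
    by (intro continuous_intros continuous_on_compose2[OF cont_coord[of UNIV] contE]) (auto simp: D_def)
  have contX: "continuous_on D (\<lambda>w. X (sphere_chart P w))"
  proof -
    have "continuous_on D (\<lambda>w. \<Phi> (f w) + hgt w *\<^sub>R N)"
      unfolding planar_frame_def hgt_def
      by (intro continuous_intros contf contE) (auto simp: D_def)
    then show ?thesis using X by (simp cong: continuous_on_cong_simp)
  qed
  have contfinv: "continuous_on (f ` D) finv"
    by (rule continuous_on_inverse_open[OF _ contf]) (auto simp: D_def finv)
  have asymp: "(\<lambda>y. u y - (- \<mu> * ln (norm y) + d)) \<in> O[inf at_infinity (principal {y. y \<bullet> N = 0})](\<lambda>y. 1 / norm y)"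
  proof -
    obtain R W where R: "R > 0" "W \<subseteq> ball 0 \<delta>" "f ` (W - {0}) = {v. norm v > R}"
      using nbhds[of \<delta>] \<delta> unfolding f_def[abs_def] by blast
    define c where "c = (2 * K * \<bar>\<mu>\<bar> + M) * (2 * norm p)"
    have "norm (u y - (- \<mu> * ln (norm y) + d)) \<le> c * norm (1 / norm y)"
      if y: "y \<bullet> N = 0" "norm y \<ge> norm p * (R + 1)" for y
    proof -
      define v where "v = coord y"
      have yv: "y = \<Phi> v" using frame_coord[OF y(1)] by (simp add: v_def)
      have ny: "norm y = norm p * norm v" unfolding yv by (rule norm_frame)
      then have "norm v \<ge> R + 1" using y(2) p0 by simp
      then have "v \<in> f ` (W - {0})" using R by auto
      then obtain w where "w \<in> W - {0}" "v = f w" by blast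
      then have w: "w \<in> D" "v = f w" using R(2) by (auto simp: D_def)
      have w': "w \<in> ball 0 \<delta>" "w \<noteq> 0" using w by (auto simp: D_def)
      have v0: "norm v > 0" using \<open>norm v \<ge> R + 1\<close> R(1) by linarith
      have wv: "norm (w * v - 1) \<le> K * norm w" "K * norm w \<le> 1 / 2"
        using K[OF w'(1)] w'(2) w(2) by (auto simp: f_def)
      have near: "\<bar>norm (w * v) - 1\<bar> \<le> K * norm w"
        using wv(1) norm_triangle_ineq3[of "w * v" 1] by simp
      have "\<bar>ln (norm (w * v))\<bar> \<le> 2 * (K * norm w)"
        by (rule order_trans[OF abs_ln_le_twice_diff[OF order_trans[OF near wv(2)]]]) (use near in simp)
      then have 1: "\<bar>\<mu> * ln (norm (w * v))\<bar> \<le> \<bar>\<mu>\<bar> * (2 * (K * norm w))"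
        by (simp add: abs_mult mult_left_mono)
      have "\<bar>(E w - E 0) \<bullet> N\<bar> \<le> norm (E w - E 0) * norm N" by (rule Cauchy_Schwarz_ineq2)
      also have "\<dots> \<le> M * norm w"
        using lipschitz_onD[OF lipE, of w 0] w' \<delta> norm_N by (simp add: dist_norm)
      finally have 2: "\<bar>(E w - E 0) \<bullet> N\<bar> \<le> M * norm w" .
      have "u y - (- \<mu> * ln (norm y) + d) = \<mu> * ln (norm (w * v)) + (E w - E 0) \<bullet> N"
      proof -
        have "u y = hgt w" by (simp add: u_def w(2) finv[OF w(1)] flip: v_def)
        moreover have "ln (norm y) = ln (norm p) + ln (norm v)" unfolding ny using p0 v0 by (simp add: ln_mult)
        moreover have "ln (norm (w * v)) = ln (norm w) + ln (norm v)" using w' v0 by (simp add: norm_mult ln_mult)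
        ultimately show ?thesis by (simp add: hgt_def d_def inner_diff_left algebra_simps)
      qed
      then have "norm (u y - (- \<mu> * ln (norm y) + d)) \<le> (2 * K * \<bar>\<mu>\<bar> + M) * norm w"
        using 1 2 by (simp add: algebra_simps)
      also have "norm w \<le> 2 / norm v"
      proof -
        have "norm w * norm v \<le> 2" using near wv(2) by (simp add: norm_mult)
        then show ?thesis using v0 by (simp add: field_simps)
      qed
      then have "(2 * K * \<bar>\<mu>\<bar> + M) * norm w \<le> (2 * K * \<bar>\<mu>\<bar> + M) * (2 / norm v)"
        using \<delta>(3) \<open>M \<ge> 0\<close> by (intro mult_left_mono) auto
      also have "\<dots> = c * norm (1 / norm y)" using p0 v0 by (simp add: c_def ny field_simps)
      finally show ?thesis .
    qed
    then show ?thesis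
      by (intro bigoI[of _ c]) (auto simp: eventually_inf_principal eventually_at_infinity)
  qed
  have nbhd: "\<exists>U K \<Omega>. openin riemann_sphere U \<and> P \<in> U \<and> U \<subseteq> V \<and>
             embedding_map (subtopology riemann_sphere (U - {P})) euclidean X \<and>
             compact K \<and> openin (top_of_set {y. y \<bullet> N = 0}) \<Omega> \<and> connected \<Omega> \<and> \<Omega> \<noteq> {} \<and> bounded \<Omega> \<and>
             X ` (U - {P}) - K = (\<lambda>y. y + u y *\<^sub>R N) ` ({y. y \<bullet> N = 0} - closure \<Omega>)"
    if V: "openin riemann_sphere V" "P \<in> V" for V
  proof -
    have "openin euclidean {w \<in> topspace euclidean. sphere_chart P w \<in> V}"
      using continuous_map_sphere_chart V(1) by (rule openin_continuous_map_preimage)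
    then have "open {w. sphere_chart P w \<in> V}" by simp
    moreover have "0 \<in> {w. sphere_chart P w \<in> V}" using V by simp
    ultimately obtain \<eta>0 where \<eta>0: "\<eta>0 > 0" "ball 0 \<eta>0 \<subseteq> {w. sphere_chart P w \<in> V}"
      using openE by blast
    obtain R W where R: "R > 0" "open W" "0 \<in> W" "W \<subseteq> ball 0 (min \<eta>0 \<delta>)" "f ` (W - {0}) = {v. norm v > R}"
      using nbhds[of "min \<eta>0 \<delta>"] \<delta> \<eta>0 unfolding f_def[abs_def] by auto
    define U where "U = sphere_chart P ` W"
    define S where "S = W - {0}"
    have SD: "S \<subseteq> D" using R(4) by (auto simp: S_def D_def)
    have US: "U - {P} = sphere_chart P ` S"
      using inj_sphere_chart[of P UNIV] unfolding U_def S_def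
      by (simp add: image_set_diff)
    have "homeomorphism S ((\<lambda>w. X (sphere_chart P w)) ` S) (\<lambda>w. X (sphere_chart P w)) (\<lambda>y. finv (coord y))"
    proof (rule homeomorphismI)
      show "continuous_on ((\<lambda>w. X (sphere_chart P w)) ` S) (\<lambda>y. finv (coord y))"
        by (rule continuous_on_compose2[OF contfinv cont_coord]) (use SD coordX in auto)
    qed (use continuous_on_subset[OF contX SD] SD coordX finv in auto)
    then have "embedding_map (top_of_set S) euclidean (X \<circ> sphere_chart P)"
      using homeomorphism_imp_embedding_map unfolding comp_def by blast
    then have "embedding_map (subtopology riemann_sphere (U - {P})) euclidean X"
      unfolding US by (rule embedding_map_of_homeomorphic_reparametrization[OF homeomorphic_map_sphere_chart])
    moreover have "openin riemann_sphere U"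
      using R(2) open_map_sphere_chart[of P] by (auto simp: U_def open_map_def)
    moreover have "P \<in> U" using R(3) unfolding U_def by (metis image_eqI sphere_chart_0)
    moreover have "W \<subseteq> ball 0 \<eta>0" using R(4) by auto
    then have "U \<subseteq> V" using \<eta>0(2) by (auto simp: U_def)
    moreover have "connected (\<Phi> ` ball 0 R)"
      by (intro connected_linear_image linear_frame) simp
    moreover have "bounded (\<Phi> ` ball 0 R)"
      using linear_frame linear_conv_bounded_linear bounded_linear_image bounded_ball by blast
    moreover have "\<Phi> ` ball 0 R \<noteq> {}" using R(1) by simp
    moreover have "X ` (U - {P}) - {} = (\<lambda>y. y + u y *\<^sub>R N) ` ({y. y \<bullet> N = 0} - closure (\<Phi> ` ball 0 R))"
    proof -
      have "(\<lambda>y. y + u y *\<^sub>R N) ` ({y. y \<bullet> N = 0} - closure (\<Phi> ` ball 0 R))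
          = (\<lambda>w. \<Phi> (f w) + hgt (finv (f w)) *\<^sub>R N) ` S"
        unfolding plane_minus_closure_disc[OF R(1)] R(5)[symmetric] S_def
        by (simp add: image_image u_def)
      also have "\<dots> = (\<lambda>w. X (sphere_chart P w)) ` S"
        by (rule image_cong) (use SD X finv in auto)
      finally show ?thesis by (simp add: US image_image)
    qed
    ultimately show ?thesis
      by (intro exI[of _ U] exI[of _ "{}"] exI[of _ "\<Phi> ` ball 0 R"] conjI openin_frame_disc compact_empty)
  qed
  show ?thesis unfolding graph_end_def Let_def
    by (intro exI[of _ u] exI[of _ d] conjI asymp allI impI nbhd) auto
qed

end

section \<open>Logarithmic expansions at an end\<close>

text \<open>
  The real and imaginary parts of the two bilinear equations are exactly the orthogonality and
  equal-length conditions of an \<^locale>\<open>end_frame\<close>.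
\<close>
lemma end_frame_of_null_vector:
  fixes C :: "3 \<Rightarrow> complex" and N :: "real ^ 3"
  assumes null: "(\<Sum>j\<in>UNIV. (C j)\<^sup>2) = 0" and perp: "(\<Sum>j\<in>UNIV. C j * of_real (N $ j)) = 0"
    and nz: "C i \<noteq> 0" and N: "norm N = 1"
  shows "end_frame (\<chi> j. Re (C j)) (\<chi> j. Im (C j)) N"
proof
  have "(\<Sum>j\<in>UNIV. (Re (C j))\<^sup>2 - (Im (C j))\<^sup>2) = 0" "(\<Sum>j\<in>UNIV. 2 * (Re (C j) * Im (C j))) = 0"
    using arg_cong[OF null, of Re] arg_cong[OF null, of Im] by (simp_all add: power2_eq_square mult.commute)
  then have sq: "(\<Sum>j\<in>UNIV. (Re (C j))\<^sup>2) = (\<Sum>j\<in>UNIV. (Im (C j))\<^sup>2)" and prod: "(\<Sum>j\<in>UNIV. Re (C j) * Im (C j)) = 0"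
    by (simp_all add: sum_subtractf flip: sum_distrib_left)
  show "norm N = 1" by (fact N)
  show "(\<chi> j. Re (C j)) \<bullet> (\<chi> j. Im (C j)) = 0" using prod by (simp add: inner_vec_def)
  show norms: "norm (\<chi> j. Re (C j)) = norm (\<chi> j. Im (C j))"
    using sq by (simp add: norm_eq_sqrt_inner inner_vec_def power2_eq_square)
  show "(\<chi> j. Re (C j)) \<noteq> 0"
  proof
    assume "(\<chi> j. Re (C j)) = 0"
    with norms have "(\<chi> j. Re (C j)) = 0" "(\<chi> j. Im (C j)) = 0" by auto
    then have "C i = 0" by (simp add: vec_eq_iff complex_eq_iff)
    with nz show False by simp
  qed
  show "(\<chi> j. Re (C j)) \<bullet> N = 0" "(\<chi> j. Im (C j)) \<bullet> N = 0"
    using arg_cong[OF perp, of Re] arg_cong[OF perp, of Im] by (simp_all add: inner_vec_def)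
qed

definition log_pole_expansion :: "(complex \<Rightarrow> real) \<Rightarrow> complex \<Rightarrow> real \<Rightarrow> bool" where
  "log_pole_expansion f C \<mu> \<longleftrightarrow> (\<exists>F. F analytic_on {0} \<and>
     (\<forall>\<^sub>F w in at 0. f w = Re (C / w) + \<mu> * ln (norm w) + Re (F w)))"

text \<open>
  The growth vector is required to be \<open>\<mu> N\<close>; this parallelism to the normal is what removes the logarithm from
  the horizontal coordinates.
\<close>
locale null_end =
  fixes X :: "sphere \<Rightarrow> real ^ 3" and P :: sphere and C :: "3 \<Rightarrow> complex" and N :: "real ^ 3" and \<mu> :: real
  assumes null: "(\<Sum>j\<in>UNIV. (C j)\<^sup>2) = 0" and perp: "(\<Sum>j\<in>UNIV. C j * of_real (N $ j)) = 0"
    and nz: "\<exists>i. C i \<noteq> 0" and N: "norm N = 1"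
    and expansions: "\<And>j. log_pole_expansion (\<lambda>w. X (sphere_chart P w) $ j) (C j) (\<mu> * N $ j)"
begin

lemma vector_expansion:
  obtains F where "\<And>j. F j analytic_on {0}"
    "\<forall>\<^sub>F w in at 0. X (sphere_chart P w) = planar_frame (\<chi> j. Re (C j)) (\<chi> j. Im (C j)) (1 / w)
      + (\<mu> * ln (norm w)) *\<^sub>R N + (\<chi> j. Re (F j w))"
proof -
  have "\<forall>j. \<exists>F. F analytic_on {0} \<and> (\<forall>\<^sub>F w in at 0.
      X (sphere_chart P w) $ j = Re (C j / w) + \<mu> * N $ j * ln (norm w) + Re (F w))"
    using expansions unfolding log_pole_expansion_def by (rule allI)
  from choice[OF this] obtain F where F: "\<And>j. F j analytic_on {0}"
    "\<And>j. \<forall>\<^sub>F w in at 0. X (sphere_chart P w) $ j = Re (C j / w) + \<mu> * N $ j * ln (norm w) + Re (F j w)"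
    by blast
  have "\<forall>\<^sub>F w in at 0. \<forall>j. X (sphere_chart P w) $ j = Re (C j / w) + \<mu> * N $ j * ln (norm w) + Re (F j w)"
    using F(2) by (rule eventually_all_finite)
  then have "\<forall>\<^sub>F w in at 0. X (sphere_chart P w) = planar_frame (\<chi> j. Re (C j)) (\<chi> j. Im (C j)) (1 / w)
      + (\<mu> * ln (norm w)) *\<^sub>R N + (\<chi> j. Re (F j w))"
  proof (rule eventually_mono)
    fix w assume *: "\<forall>j. X (sphere_chart P w) $ j = Re (C j / w) + \<mu> * N $ j * ln (norm w) + Re (F j w)"
    have "Re (C j / w) = Re (1 / w) * Re (C j) - Im (1 / w) * Im (C j)" for j
      using times_complex.sel(1)[of "1 / w" "C j"] by simp
    with * show "X (sphere_chart P w) = planar_frame (\<chi> j. Re (C j)) (\<chi> j. Im (C j)) (1 / w)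
      + (\<mu> * ln (norm w)) *\<^sub>R N + (\<chi> j. Re (F j w))"
      by (simp add: vec_eq_iff planar_frame_def mult_ac)
  qed
  with F(1) that show thesis by blast
qed

lemma graph_end: "graph_end X P N (- \<mu>)"
proof -
  obtain i where "C i \<noteq> 0" using nz by blast
  then interpret end_frame "\<chi> j. Re (C j)" "\<chi> j. Im (C j)" N
    using end_frame_of_null_vector[OF null perp _ N] by blast
  show ?thesis by (rule vector_expansion) (rule graph_end_of_expansion; assumption)
qed

text \<open>
  The polar part is orthogonal to \<open>N\<close>, so only the logarithm survives in the unbounded part of the height. The sign \<open>s\<close>
  selects between \<open>N\<close> and \<open>- N\<close>.
\<close>
lemma height_at_top:
  assumes "s * \<mu> < 0"
  shows "filterlim (\<lambda>x. X x \<bullet> (s *\<^sub>R N)) at_top (atin riemann_sphere P)"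
proof -
  obtain i where "C i \<noteq> 0" using nz by blast
  then interpret end_frame "\<chi> j. Re (C j)" "\<chi> j. Im (C j)" N
    using end_frame_of_null_vector[OF null perp _ N] by blast
  obtain F where F: "\<And>j. F j analytic_on {0}"
    "\<forall>\<^sub>F w in at 0. X (sphere_chart P w) = planar_frame (\<chi> j. Re (C j)) (\<chi> j. Im (C j)) (1 / w)
      + (\<mu> * ln (norm w)) *\<^sub>R N + (\<chi> j. Re (F j w))"
    by (rule vector_expansion) (rule that; assumption)
  have "\<forall>\<^sub>F w in at 0. X (sphere_chart P w) \<bullet> (s *\<^sub>R N)
      = s * ((\<chi> j. Re (F j w)) \<bullet> N) + (s * \<mu>) * ln (norm w)"
    using F(2) by (rule eventually_mono) (simp add: inner_add_left algebra_simps)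
  moreover have "filterlim (\<lambda>w. s * ((\<chi> j. Re (F j w)) \<bullet> N) + (s * \<mu>) * ln (norm w)) at_top (at (0::complex))"
  proof (rule filterlim_tendsto_add_at_top)
    have "(F j \<longlongrightarrow> F j 0) (at 0)" for j
      using F(1)[of j] analytic_at_imp_isCont isContD by blast
    then show "((\<lambda>w. s * ((\<chi> j. Re (F j w)) \<bullet> N)) \<longlongrightarrow> s * ((\<chi> j. Re (F j 0)) \<bullet> N)) (at 0)"
      by (intro tendsto_intros) auto
    have "filterlim (norm :: complex \<Rightarrow> real) (at_right 0) (at 0)"
      by (auto simp: filterlim_at eventually_at_filter intro!: tendsto_eq_intros)
    then have "filterlim (\<lambda>w::complex. ln (norm w)) at_bot (at 0)"
      using filterlim_compose[OF ln_at_0] by blast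
    then show "filterlim (\<lambda>w::complex. (s * \<mu>) * ln (norm w)) at_top (at 0)"
      by (simp only: filterlim_tendsto_neg_mult_at_top_iff[OF tendsto_const assms])
  qed
  ultimately have "filterlim (\<lambda>w. X (sphere_chart P w) \<bullet> (s *\<^sub>R N)) at_top (at 0)"
    by (simp only: filterlim_cong[OF refl refl])
  then show ?thesis unfolding filterlim_at_top by (blast intro: eventually_atin_sphere_chart)
qed

end

section \<open>Logarithmic potentials\<close>

text \<open>
  Real part of the multivalued primitive \<open>Q z + (\<Sum>\<xi>. L \<xi> * log (z - \<xi>))\<close>; real coefficients make it
  single-valued.
\<close>
definition log_potential :: "complex set \<Rightarrow> (complex \<Rightarrow> real) \<Rightarrow> (complex \<Rightarrow> complex) \<Rightarrow> complex \<Rightarrow> real" where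
  "log_potential Z L Q z = Re (Q z) + (\<Sum>\<xi>\<in>Z. L \<xi> * ln (norm (z - \<xi>)))"

lemma simple_pole_decomposition:
  assumes "q analytic_on {0}"
  obtains f where "f analytic_on {0}" "\<And>w. w \<noteq> 0 \<Longrightarrow> q w / w = q 0 / w + f w"
proof -
  define f where "f w = (if w = 0 then deriv q 0 else (q w - q 0) / (w - 0))" for w
  obtain r where r: "r > 0" "q holomorphic_on ball 0 r" using assms by (auto simp: analytic_on_def)
  then have "f holomorphic_on ball 0 r" unfolding f_def[abs_def] by (intro pole_lemma) auto
  then have "f analytic_on {0}" using r by (auto simp: analytic_on_def)
  moreover have "q w / w = q 0 / w + f w" if "w \<noteq> 0" for w using that by (simp add: f_def field_simps)
  ultimately show thesis using that by blast
qed

lemma log_pole_expansion_add_const: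
  assumes "log_pole_expansion f C \<mu>"
  shows "log_pole_expansion (\<lambda>w. f w + c) C \<mu>"
proof -
  obtain F where F: "F analytic_on {0}" "\<forall>\<^sub>F w in at 0. f w = Re (C / w) + \<mu> * ln (norm w) + Re (F w)"
    using assms by (auto simp: log_pole_expansion_def)
  have "(\<lambda>w. F w + of_real c) analytic_on {0}" by (intro analytic_intros F)
  moreover have "\<forall>\<^sub>F w in at 0. f w + c = Re (C / w) + \<mu> * ln (norm w) + Re (F w + of_real c)"
    using F(2) by (rule eventually_mono) simp
  ultimately show ?thesis unfolding log_pole_expansion_def by blast
qed

text \<open>
  The logarithms of the other singular points are, near \<open>p\<close>, real parts of branches of the complex
  logarithm centred at \<open>p\<close>.
\<close>
lemma log_potential_expansion_at_point:
  assumes "finite Z" "p \<in> Z" "q analytic_on {0}" "\<forall>\<^sub>F w in at 0. Q (p + w) = q w / w"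
  shows "log_pole_expansion (\<lambda>w. log_potential Z L Q (p + w)) (q 0) (L p)"
proof -
  obtain f where f: "f analytic_on {0}" "\<And>w. w \<noteq> 0 \<Longrightarrow> q w / w = q 0 / w + f w"
    using simple_pole_decomposition[OF assms(3)] by blast
  define F where "F w = f w + (\<Sum>\<xi>\<in>Z - {p}. of_real (L \<xi>) * (Ln (1 + w / (p - \<xi>)) + of_real (ln (norm (p - \<xi>)))))" for w
  have "F analytic_on {0}" unfolding F_def by (intro analytic_intros f) auto
  moreover have "\<forall>\<^sub>F w in at 0. \<forall>\<xi>\<in>Z - {p}. w \<noteq> \<xi> - p"
    using assms(1) by (intro eventually_ball_finite) (auto intro: eventually_neq_at_within)
  then have "\<forall>\<^sub>F w in at 0. log_potential Z L Q (p + w) = Re (q 0 / w) + L p * ln (norm w) + Re (F w)"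
    using assms(4) eventually_neq_at_within[of 0 0 UNIV]
  proof eventually_elim
    case (elim w)
    have "ln (norm (p + w - \<xi>)) = Re (Ln (1 + w / (p - \<xi>)) + of_real (ln (norm (p - \<xi>))))" if "\<xi> \<in> Z - {p}" for \<xi>
    proof -
      have "w \<noteq> \<xi> - p" "p - \<xi> \<noteq> 0" using elim that by auto
      then have eq: "p + w - \<xi> = (1 + w / (p - \<xi>)) * (p - \<xi>)" by (simp add: field_simps)
      have "p + w - \<xi> \<noteq> 0" using \<open>w \<noteq> \<xi> - p\<close> by (simp add: algebra_simps eq_diff_eq add.commute)
      then have "1 + w / (p - \<xi>) \<noteq> 0" unfolding eq by simp
      then show ?thesis unfolding eq using \<open>p - \<xi> \<noteq> 0\<close> by (simp add: norm_mult ln_mult)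
    qed
    then have "(\<Sum>\<xi>\<in>Z - {p}. L \<xi> * ln (norm (p + w - \<xi>))) = Re (F w) - Re (f w)"
      by (simp add: F_def)
    then show ?case using elim f(2)[of w] assms(1,2)
      by (simp add: log_potential_def sum.remove[of Z p])
  qed
  ultimately show ?thesis unfolding log_pole_expansion_def by blast
qed

text \<open>
  Every term contributes through \<open>ln \<bar>1 / w - \<xi>\<bar> = ln \<bar>1 - w * \<xi>\<bar> - ln \<bar>w\<bar>\<close>, so the total logarithmic
  coefficient at infinity is minus the sum of the finite ones.
\<close>
lemma log_potential_expansion_at_infinity:
  assumes "finite Z" "q analytic_on {0}" "\<forall>\<^sub>F w in at 0. Q (1 / w) = q w / w"
  shows "log_pole_expansion (\<lambda>w. log_potential Z L Q (1 / w)) (q 0) (- (\<Sum>\<xi>\<in>Z. L \<xi>))"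
proof -
  obtain f where f: "f analytic_on {0}" "\<And>w. w \<noteq> 0 \<Longrightarrow> q w / w = q 0 / w + f w"
    using simple_pole_decomposition[OF assms(2)] by blast
  define F where "F w = f w + (\<Sum>\<xi>\<in>Z. of_real (L \<xi>) * Ln (1 - w * \<xi>))" for w
  have "F analytic_on {0}" unfolding F_def by (intro analytic_intros f) auto
  moreover have "\<forall>\<^sub>F w in at 0. w * \<xi> \<noteq> 1" for \<xi> :: complex
    using eventually_neq_at_within[of "1 / \<xi>" 0 UNIV] by (rule eventually_mono) (metis mult_zero_right nonzero_eq_divide_eq zero_neq_one)
  then have "\<forall>\<^sub>F w in at 0. \<forall>\<xi>\<in>Z. w * \<xi> \<noteq> 1"
    using assms(1) by (intro eventually_ball_finite) auto
  then have "\<forall>\<^sub>F w in at 0. log_potential Z L Q (1 / w) = Re (q 0 / w) + - (\<Sum>\<xi>\<in>Z. L \<xi>) * ln (norm w) + Re (F w)"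
    using assms(3) eventually_neq_at_within[of 0 0 UNIV]
  proof eventually_elim
    case (elim w)
    have "L \<xi> * ln (norm (1 / w - \<xi>)) = L \<xi> * Re (Ln (1 - w * \<xi>)) - L \<xi> * ln (norm w)" if "\<xi> \<in> Z" for \<xi>
    proof -
      have eq: "1 / w - \<xi> = (1 - w * \<xi>) / w" using elim by (simp add: field_simps)
      have "1 - w * \<xi> \<noteq> 0" using elim that by auto
      then show ?thesis unfolding eq using elim by (simp add: norm_divide ln_div algebra_simps)
    qed
    then have "(\<Sum>\<xi>\<in>Z. L \<xi> * ln (norm (1 / w - \<xi>))) = Re (F w) - Re (f w) - (\<Sum>\<xi>\<in>Z. L \<xi>) * ln (norm w)"
      by (simp add: F_def sum_subtractf sum_distrib_right)
    then show ?case using elim f(2)[of w] by (simp add: log_potential_def)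
  qed
  ultimately show ?thesis unfolding log_pole_expansion_def by blast
qed

lemma log_potential_has_derivative:
  assumes "finite Z" "z \<notin> Z" "(Q has_field_derivative Q') (at z)"
  shows "(log_potential Z L Q has_derivative (\<lambda>v. Re ((Q' + (\<Sum>\<xi>\<in>Z. of_real (L \<xi>) / (z - \<xi>))) * v))) (at z)"
proof -
  have log_deriv: "((\<lambda>z. ln (norm (z - \<xi>))) has_derivative (\<lambda>v. Re (v / (z - \<xi>)))) (at z)" if "z \<noteq> \<xi>" for \<xi>
  proof -
    have n: "norm (z - \<xi>) > 0" using that by simp
    have "((\<lambda>z. z - \<xi>) has_derivative (\<lambda>v. v)) (at z)" by (auto intro!: derivative_eq_intros)
    then have "((\<lambda>z. norm (z - \<xi>)) has_derivative (\<lambda>v. v \<bullet> sgn (z - \<xi>))) (at z)"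
      by (rule has_derivative_compose) (rule has_derivative_norm, use that in simp)
    then have "((\<lambda>z. ln (norm (z - \<xi>))) has_derivative (\<lambda>v. (v \<bullet> sgn (z - \<xi>)) * (1 / norm (z - \<xi>)))) (at z)"
      using n by (auto intro!: derivative_eq_intros simp: divide_inverse)
    moreover have "(v \<bullet> sgn (z - \<xi>)) * (1 / norm (z - \<xi>)) = Re (v / (z - \<xi>))" for v
    proof -
      have "(v \<bullet> sgn (z - \<xi>)) * (1 / norm (z - \<xi>)) = (v \<bullet> (z - \<xi>)) / (norm (z - \<xi>))\<^sup>2"
        by (simp add: sgn_div_norm power2_eq_square divide_inverse del: scaleR_diff_right inner_diff_right)
      also have "\<dots> = Re (v / (z - \<xi>))"
        unfolding cmod_power2 Re_divide inner_complex_def ..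
      finally show ?thesis .
    qed
    ultimately show ?thesis by simp
  qed
  have "((\<lambda>z. Re (Q z)) has_derivative (\<lambda>v. Re (Q' * v))) (at z)"
    using has_derivative_Re[OF assms(3)[unfolded has_field_derivative_def]] .
  moreover have "((\<lambda>z. \<Sum>\<xi>\<in>Z. L \<xi> * ln (norm (z - \<xi>))) has_derivative (\<lambda>v. \<Sum>\<xi>\<in>Z. L \<xi> * Re (v / (z - \<xi>)))) (at z)"
    by (intro has_derivative_sum has_derivative_mult_right log_deriv) (use assms(2) in auto)
  ultimately have "((\<lambda>z. Re (Q z) + (\<Sum>\<xi>\<in>Z. L \<xi> * ln (norm (z - \<xi>)))) has_derivative
      (\<lambda>v. Re (Q' * v) + (\<Sum>\<xi>\<in>Z. L \<xi> * Re (v / (z - \<xi>))))) (at z)"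
    by (rule has_derivative_add)
  moreover have "Re (Q' * v) + (\<Sum>\<xi>\<in>Z. L \<xi> * Re (v / (z - \<xi>))) = Re ((Q' + (\<Sum>\<xi>\<in>Z. of_real (L \<xi>) / (z - \<xi>))) * v)" for v
  proof -
    have "L \<xi> * Re (v / (z - \<xi>)) = Re (of_real (L \<xi>) / (z - \<xi>) * v)" for \<xi>
    proof -
      have "of_real (L \<xi>) / (z - \<xi>) * v = of_real (L \<xi>) * (v / (z - \<xi>))" by simp
      then show ?thesis by (simp only: Re_complex_of_real times_complex.sel Im_complex_of_real)
    qed
    then show ?thesis by (simp add: distrib_right sum_distrib_right)
  qed
  ultimately show ?thesis unfolding log_potential_def[abs_def] by simp
qed

lemma log_pole_expansion_cong:
  assumes "\<forall>\<^sub>F w in at 0. f w = g w" "log_pole_expansion f C \<mu>"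
  shows "log_pole_expansion g C \<mu>"
proof -
  obtain F where F: "F analytic_on {0}" "\<forall>\<^sub>F w in at 0. f w = Re (C / w) + \<mu> * ln (norm w) + Re (F w)"
    using assms(2) by (auto simp: log_pole_expansion_def)
  have "\<forall>\<^sub>F w in at 0. g w = Re (C / w) + \<mu> * ln (norm w) + Re (F w)"
    using assms(1) F(2) by eventually_elim simp
  with F(1) show ?thesis unfolding log_pole_expansion_def by blast
qed

section \<open>Integration along curves on the sphere\<close>

definition plane_part :: "sphere set \<Rightarrow> complex set" where
  "plane_part P = {z. Some z \<notin> P}"

lemma open_plane_part: "finite P \<Longrightarrow> open (plane_part P)"
proof -
  assume "finite P"
  then have "finite (Some -` P)" by (rule finite_vimageI) simp
  moreover have "plane_part P = - (Some -` P)" by (auto simp: plane_part_def)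
  ultimately show ?thesis by (simp add: open_Compl finite_imp_closed)
qed

text \<open>
  Since infinity is a puncture, a curve never leaves the plane. Differentiability is
  known only on small intervals around each parameter, in coordinates that differ from the planar
  one by a translation; the end points join the exceptional set because derivatives there would
  see values of the curve outside the unit interval.
\<close>
lemma sphere_curve_planar_lift:
  assumes curve: "sphere_curve P \<gamma>" and "None \<in> P"
  obtains g where "\<And>t. t \<in> {0..1} \<Longrightarrow> \<gamma> t = Some (g t)" "valid_path g" "path_image g \<subseteq> plane_part P"
proof -
  define g where "g t = the (\<gamma> t)" for t
  have cm: "continuous_map (top_of_set {0..1}) (subtopology riemann_sphere (- P)) \<gamma>"
    using curve by (simp add: sphere_curve_def pathin_def)
  then have cm': "continuous_map (top_of_set {0..1}) riemann_sphere \<gamma>" and avoid: "\<gamma> ` {0..1} \<subseteq> - P"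
    by (auto simp: continuous_map_in_subtopology)
  have \<gamma>: "\<gamma> t = Some (g t)" if "t \<in> {0..1}" for t
  proof -
    have "\<gamma> t \<notin> P" using that avoid by blast
    then show ?thesis using assms(2) by (cases "\<gamma> t") (auto simp: g_def)
  qed
  have "openin (top_of_set {0..1}) {t \<in> {0..1}. g t \<in> U}" if "open U" for U
  proof -
    have "openin riemann_sphere (Some ` U)" using that by (simp add: riemann_sphere_def)
    then have "openin (top_of_set {0..1}) {t \<in> topspace (top_of_set {0..1}). \<gamma> t \<in> Some ` U}"
      by (rule openin_continuous_map_preimage[OF cm'])
    moreover have "{t \<in> topspace (top_of_set {0..1}). \<gamma> t \<in> Some ` U} = {t \<in> {0..1}. g t \<in> U}"
      using \<gamma> by (auto simp: image_iff)
    ultimately show ?thesis by simp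
  qed
  then have "continuous_map (top_of_set {0..1}) euclidean g" by (simp add: continuous_map_def)
  then have cont: "continuous_on {0..1} g" by simp
  obtain S where S: "finite S" "\<And>t. t \<in> {0..1} - S \<Longrightarrow> \<exists>e>0.
        (\<lambda>s. local_coord (\<gamma> t) (\<gamma> s)) C1_differentiable_on ({0..1} \<inter> ball t e - S)"
    using curve unfolding sphere_curve_def by blast
  define S' where "S' = S \<union> {0, 1}"
  have local_C1: "g differentiable at t \<and> isCont (\<lambda>x. vector_derivative g (at x)) t" if t: "t \<in> {0..1} - S'" for t
  proof -
    have "t \<in> {0..1} - S" using t by (auto simp: S'_def)
    then obtain e where "e > 0"
      "(\<lambda>s. local_coord (\<gamma> t) (\<gamma> s)) C1_differentiable_on ({0..1} \<inter> ball t e - S)"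
      using S(2) by blast
    then obtain D where D: "\<And>x. x \<in> {0..1} \<inter> ball t e - S \<Longrightarrow>
        ((\<lambda>s. local_coord (\<gamma> t) (\<gamma> s)) has_vector_derivative D x) (at x)"
        "continuous_on ({0..1} \<inter> ball t e - S) D"
      unfolding C1_differentiable_on_def by blast
    define A where "A = {0<..<1} \<inter> ball t e - S"
    have "open A" unfolding A_def by (intro open_Diff open_Int finite_imp_closed S) auto
    have A: "A \<subseteq> {0..1} \<inter> ball t e - S" and "t \<in> A"
      using t \<open>e > 0\<close> by (auto simp: A_def S'_def)
    have deriv: "(g has_vector_derivative D x) (at x)" if "x \<in> A" for x
    proof -
      have "((\<lambda>s. g s - g t) has_vector_derivative D x) (at x)"
      proof (rule has_vector_derivative_transform_within_open[OF D(1) \<open>open A\<close> that])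
        show "x \<in> {0..1} \<inter> ball t e - S" using that A by blast
        show "local_coord (\<gamma> t) (\<gamma> s) = g s - g t" if "s \<in> A" for s
        proof -
          have "s \<in> {0..1}" "t \<in> {0..1}" using that A \<open>t \<in> A\<close> by blast+
          then show ?thesis by (simp only: \<gamma> local_coord.simps)
        qed
      qed
      from has_vector_derivative_add[OF this has_vector_derivative_const[of "g t"]]
      show ?thesis by simp
    qed
    have "continuous_on A (\<lambda>x. vector_derivative g (at x))"
      using continuous_on_subset[OF D(2) A] vector_derivative_at[OF deriv]
      by (simp cong: continuous_on_cong)
    then have "isCont (\<lambda>x. vector_derivative g (at x)) t"
      using \<open>open A\<close> \<open>t \<in> A\<close> continuous_on_eq_continuous_at by blast
    moreover have "g differentiable at t" using deriv[OF \<open>t \<in> A\<close>] by (rule differentiableI_vector)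
    ultimately show ?thesis by blast
  qed
  have "g C1_differentiable_on ({0..1} - S')"
    unfolding C1_differentiable_on_eq
    using local_C1 continuous_at_imp_continuous_on by blast
  moreover have "finite S'" using S by (simp add: S'_def)
  ultimately have "valid_path g"
    using cont unfolding valid_path_def piecewise_C1_differentiable_on_def by blast
  moreover have "path_image g \<subseteq> plane_part P"
    using \<gamma> avoid by (fastforce simp: path_image_def plane_part_def)
  ultimately show thesis using that \<gamma> by blast
qed

lemma form_integral_eq_contour_integral:
  assumes lift: "\<And>t. t \<in> {0..1} \<Longrightarrow> \<gamma> t = Some (g t)"
    and form: "\<And>z. z \<in> path_image g \<Longrightarrow> remove_sings (local_form h (Some z)) 0 = \<phi> z"
    and int: "(\<phi> has_contour_integral i) g"
  shows "form_integral h \<gamma> = i"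
proof -
  have eq: "remove_sings (local_form h (\<gamma> t)) 0 * vector_derivative (\<lambda>s. local_coord (\<gamma> t) (\<gamma> s)) (at t within {0..1})
      = \<phi> (g t) * vector_derivative g (at t within {0..1})" if t: "t \<in> {0..1}" for t
  proof -
    have "((\<lambda>s. local_coord (\<gamma> t) (\<gamma> s)) has_vector_derivative D) (at t within {0..1}) \<longleftrightarrow>
        (g has_vector_derivative D) (at t within {0..1})" for D
    proof
      assume "((\<lambda>s. local_coord (\<gamma> t) (\<gamma> s)) has_vector_derivative D) (at t within {0..1})"
      then have "((\<lambda>s. g s - g t) has_vector_derivative D) (at t within {0..1})"
        by (rule has_vector_derivative_transform[OF t, rotated]) (use t lift in auto)
      from has_vector_derivative_add[OF this has_vector_derivative_const[of "g t"]]
      show "(g has_vector_derivative D) (at t within {0..1})" by simp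
    next
      assume "(g has_vector_derivative D) (at t within {0..1})"
      from has_vector_derivative_diff[OF this has_vector_derivative_const[of "g t"]]
      have "((\<lambda>s. g s - g t) has_vector_derivative D) (at t within {0..1})" by simp
      then show "((\<lambda>s. local_coord (\<gamma> t) (\<gamma> s)) has_vector_derivative D) (at t within {0..1})"
        by (rule has_vector_derivative_transform[OF t, rotated]) (use t lift in auto)
    qed
    then have "vector_derivative (\<lambda>s. local_coord (\<gamma> t) (\<gamma> s)) (at t within {0..1}) = vector_derivative g (at t within {0..1})"
      by (simp add: vector_derivative_def)
    moreover have "g t \<in> path_image g" using t by (simp add: path_image_def)
    ultimately show ?thesis using lift[OF t] form by simp
  qed
  have "((\<lambda>t. remove_sings (local_form h (\<gamma> t)) 0 * vector_derivative (\<lambda>s. local_coord (\<gamma> t) (\<gamma> s)) (at t within {0..1}))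
      has_integral i) {0..1}"
    using int by (simp only: has_contour_integral_def has_integral_cong[OF eq])
  then show ?thesis unfolding form_integral_def by (rule integral_unique)
qed

text \<open>
  Only the real part of the integral has a single-valued primitive, so the fundamental theorem of
  calculus is applied to \<open>\<Psi> \<circ> g\<close>; existence of the complex integral comes from holomorphy of \<open>\<phi>\<close>.
\<close>
lemma Re_contour_integral_of_real_primitive:
  fixes \<Psi> :: "complex \<Rightarrow> real"
  assumes g: "valid_path g" "path_image g \<subseteq> S" and S: "open S" and \<phi>: "\<phi> holomorphic_on S"
    and deriv: "\<And>z. z \<in> S \<Longrightarrow> (\<Psi> has_derivative (\<lambda>v. Re (\<phi> z * v))) (at z)"
  obtains i where "(\<phi> has_contour_integral i) g" "Re i = \<Psi> (pathfinish g) - \<Psi> (pathstart g)"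
proof -
  have "\<phi> contour_integrable_on g" using contour_integrable_holomorphic_simple[OF \<phi> S g] .
  then obtain i where i: "(\<phi> has_contour_integral i) g" by (auto simp: contour_integrable_on_def)
  then have "((\<lambda>t. \<phi> (g t) * vector_derivative g (at t)) has_integral i) {0..1}"
    by (simp add: has_contour_integral)
  from has_integral_linear[OF this bounded_linear_Re]
  have 1: "((\<lambda>t. Re (\<phi> (g t) * vector_derivative g (at t))) has_integral Re i) {0..1}"
    by (simp add: o_def)
  obtain T where T: "finite T" "continuous_on {0..1} g" "g C1_differentiable_on ({0..1} - T)"
    using g(1) by (auto simp: valid_path_def piecewise_C1_differentiable_on_def)
  have inS: "g t \<in> S" if "t \<in> {0..1}" for t using that g(2) by (auto simp: path_image_def)
  have 2: "((\<lambda>t. Re (\<phi> (g t) * vector_derivative g (at t))) has_integral (\<Psi> (g 1) - \<Psi> (g 0))) {0..1}"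
  proof (rule fundamental_theorem_of_calculus_interior_strong[OF T(1), where f = "\<lambda>t. \<Psi> (g t)"])
    have "continuous_on S \<Psi>"
      using deriv has_derivative_continuous continuous_at_imp_continuous_on by blast
    then show "continuous_on {0..1} (\<lambda>t. \<Psi> (g t))"
      by (rule continuous_on_compose2[OF _ T(2)]) (use inS in auto)
    fix t assume t: "t \<in> {0<..<1} - T"
    then have "g differentiable (at t)" using T(3) by (auto simp: C1_differentiable_on_eq)
    then have "(g has_vector_derivative vector_derivative g (at t)) (at t)"
      by (simp add: vector_derivative_works)
    then have "(g has_derivative (\<lambda>h. h *\<^sub>R vector_derivative g (at t))) (at t)"
      by (simp add: has_vector_derivative_def)
    from has_derivative_compose[OF this deriv[OF inS]] t
    have "((\<lambda>t. \<Psi> (g t)) has_derivative (\<lambda>h. Re (\<phi> (g t) * (h *\<^sub>R vector_derivative g (at t))))) (at t)" by auto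
    moreover have "Re (\<phi> (g t) * (h *\<^sub>R vector_derivative g (at t))) = h *\<^sub>R Re (\<phi> (g t) * vector_derivative g (at t))" for h
      by (simp add: algebra_simps)
    ultimately show "((\<lambda>t. \<Psi> (g t)) has_vector_derivative Re (\<phi> (g t) * vector_derivative g (at t))) (at t)"
      by (simp add: has_vector_derivative_def)
  qed simp
  from has_integral_unique[OF 1 2] that[OF i] show thesis by (simp add: pathfinish_def pathstart_def)
qed

text \<open>
  The complement of finitely many points is open and connected, and polynomial paths are smooth.
\<close>
lemma exists_sphere_curve:
  assumes "finite P" "Some a \<notin> P" "Some b \<notin> P"
  shows "\<exists>\<gamma>. sphere_curve P \<gamma> \<and> \<gamma> 0 = Some a \<and> \<gamma> 1 = Some b"
proof -
  have "finite (Some -` P)" using assms(1) by (rule finite_vimageI) simp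
  then have "connected (UNIV - Some -` P)"
    by (intro connected_open_delete_finite) auto
  moreover have eq: "plane_part P = UNIV - Some -` P" by (auto simp: plane_part_def)
  ultimately have "connected (plane_part P)" by simp
  moreover have "a \<in> plane_part P" "b \<in> plane_part P" using assms by (auto simp: plane_part_def)
  ultimately obtain f where f: "polynomial_function f" "path_image f \<subseteq> plane_part P" "pathstart f = a" "pathfinish f = b"
    using connected_open_polynomial_connected[OF open_plane_part[OF assms(1)]] by metis
  define \<gamma> where "\<gamma> = Some \<circ> f"
  obtain f' where f': "polynomial_function f'" "\<And>x. (f has_vector_derivative f' x) (at x)"
    using has_vector_derivative_polynomial_function[OF f(1)] by blast
  have "continuous_map (top_of_set {0..1}) riemann_sphere \<gamma>"
    unfolding \<gamma>_def riemann_sphere_def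
    by (rule continuous_map_compose[OF _ continuous_map_Some])
       (use continuous_on_polymonial_function[OF f(1)] in auto)
  moreover have "\<gamma> ` {0..1} \<subseteq> - P" using f(2) by (auto simp: \<gamma>_def path_image_def plane_part_def)
  ultimately have "pathin (subtopology riemann_sphere (- P)) \<gamma>"
    by (auto simp: pathin_def continuous_map_in_subtopology)
  moreover have "(\<lambda>s. local_coord (\<gamma> t) (\<gamma> s)) C1_differentiable_on A" for t A
  proof -
    have "((\<lambda>s. f s - f t) has_vector_derivative f' x) (at x)" for x
      using has_vector_derivative_diff[OF f'(2) has_vector_derivative_const[of "f t"]] by simp
    moreover have "continuous_on A f'" using f'(1) by (rule continuous_on_polymonial_function)
    ultimately show ?thesis unfolding C1_differentiable_on_def \<gamma>_def by auto
  qed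
  then have "\<exists>S. finite S \<and> (\<forall>t \<in> {0..1} - S. \<exists>e>0.
        (\<lambda>s. local_coord (\<gamma> t) (\<gamma> s)) C1_differentiable_on ({0..1} \<inter> ball t e - S))"
    by (intro exI[of _ "{}"] conjI ballI exI[of _ 1]) auto
  ultimately show ?thesis using f(3,4)
    by (intro exI[of _ \<gamma>]) (auto simp: sphere_curve_def \<gamma>_def pathstart_def pathfinish_def)
qed

section \<open>Roots of unity and the algebraic identities\<close>

lemma finite_roots_of_unity: "k > 0 \<Longrightarrow> finite {z::complex. z ^ k = 1}"
  using finite_roots_unity[of k] by simp

text \<open>
  If \<open>k\<close> does not divide \<open>n\<close>, some root of unity \<open>\<omega>\<close> has \<open>\<omega> ^ n \<noteq> 1\<close>, by counting the roots of unity of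
  the smaller order \<open>n mod k\<close>. Multiplication by \<open>\<omega>\<close> permutes the roots and multiplies the sum by
  \<open>\<omega> ^ n\<close>, so the sum vanishes.
\<close>
lemma sum_powers_roots_of_unity:
  assumes "k > 0"
  shows "(\<Sum>\<zeta>::complex | \<zeta> ^ k = 1. \<zeta> ^ n) = (if k dvd n then of_nat k else (0::complex))"
proof (cases "k dvd n")
  case True
  then obtain c where "n = k * c" by auto
  then have "(\<Sum>\<zeta>::complex | \<zeta> ^ k = 1. \<zeta> ^ n) = (\<Sum>\<zeta>::complex | \<zeta> ^ k = 1. 1)"
    by (intro sum.cong) (auto simp: power_mult)
  then show ?thesis using True assms by (simp add: card_roots_unity_eq)
next
  case False
  define r where "r = n mod k"
  have r: "0 < r" "r < k" using False assms by (auto simp: r_def mod_greater_zero_iff_not_dvd)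
  have "\<not> {z::complex. z ^ k = 1} \<subseteq> {z. z ^ r = 1}"
  proof
    assume "{z::complex. z ^ k = 1} \<subseteq> {z. z ^ r = 1}"
    then have "card {z::complex. z ^ k = 1} \<le> card {z::complex. z ^ r = 1}"
      by (intro card_mono finite_roots_of_unity r)
    then show False using r assms by (simp add: card_roots_unity_eq)
  qed
  then obtain \<omega> :: complex where \<omega>: "\<omega> ^ k = 1" "\<omega> ^ r \<noteq> 1" by auto
  have "\<omega> ^ n = \<omega> ^ (k * (n div k) + r)" by (simp add: r_def)
  also have "\<dots> = \<omega> ^ r" using \<omega> by (simp add: power_add power_mult)
  finally have "\<omega> ^ n \<noteq> 1" using \<omega> by simp
  have "\<omega> \<noteq> 0" using \<omega> assms by (auto simp: power_0_left)
  then have "bij_betw (\<lambda>\<zeta>. \<omega> * \<zeta>) {\<zeta>. \<zeta> ^ k = 1} {\<zeta>. \<zeta> ^ k = 1}"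
    by (intro bij_betw_byWitness[where f' = "\<lambda>\<zeta>. \<zeta> / \<omega>"]) (use \<omega> in \<open>auto simp: power_mult_distrib power_divide\<close>)
  then have "(\<Sum>\<zeta>::complex | \<zeta> ^ k = 1. \<zeta> ^ n) = (\<Sum>\<zeta>::complex | \<zeta> ^ k = 1. (\<omega> * \<zeta>) ^ n)"
    by (rule sum.reindex_bij_betw[symmetric])
  also have "\<dots> = \<omega> ^ n * (\<Sum>\<zeta>::complex | \<zeta> ^ k = 1. \<zeta> ^ n)"
    by (simp add: power_mult_distrib sum_distrib_left)
  finally have "(1 - \<omega> ^ n) * (\<Sum>\<zeta>::complex | \<zeta> ^ k = 1. \<zeta> ^ n) = 0" by (simp add: algebra_simps)
  then show ?thesis using False \<open>\<omega> ^ n \<noteq> 1\<close> by simp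
qed

text \<open>
  After multiplication by \<open>z ^ k - 1\<close> the summands become geometric sums in \<open>z\<close> and \<open>\<zeta>\<close>, and
  orthogonality of the powers of \<open>\<zeta>\<close> leaves a single power of \<open>z\<close>. The exponents \<open>m = 1\<close>, \<open>k - 1\<close> and
  \<open>k\<close> give the weights \<open>\<zeta>\<close>, \<open>cnj \<zeta>\<close> and \<open>1\<close> occurring in the three coordinates.
\<close>
lemma partial_fractions_roots_of_unity:
  fixes z :: complex
  assumes m: "1 \<le> m" "m \<le> k" and z: "z ^ k \<noteq> 1"
  shows "(\<Sum>\<zeta>::complex | \<zeta> ^ k = 1. \<zeta> ^ m / (z - \<zeta>)) = of_nat k * z ^ (m - 1) / (z ^ k - 1)"
proof -
  have k: "k > 0" using m by simp
  have "\<zeta> ^ m / (z - \<zeta>) * (z ^ k - 1) = (\<Sum>i<k. z ^ i * \<zeta> ^ (m + (k - Suc i)))" if "\<zeta> ^ k = 1" for \<zeta> :: complex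
  proof -
    have "z - \<zeta> \<noteq> 0" using that z by auto
    moreover have "z ^ k - 1 = (z - \<zeta>) * (\<Sum>i<k. \<zeta> ^ (k - Suc i) * z ^ i)"
      using power_diff_sumr2[of z k \<zeta>] that by simp
    ultimately have "\<zeta> ^ m / (z - \<zeta>) * (z ^ k - 1) = \<zeta> ^ m * (\<Sum>i<k. \<zeta> ^ (k - Suc i) * z ^ i)" by simp
    also have "\<dots> = (\<Sum>i<k. z ^ i * \<zeta> ^ (m + (k - Suc i)))"
      unfolding sum_distrib_left by (rule sum.cong) (simp_all only: power_add mult_ac)
    finally show ?thesis .
  qed
  then have "(\<Sum>\<zeta>::complex | \<zeta> ^ k = 1. \<zeta> ^ m / (z - \<zeta>)) * (z ^ k - 1)
      = (\<Sum>\<zeta>::complex | \<zeta> ^ k = 1. \<Sum>i<k. z ^ i * \<zeta> ^ (m + (k - Suc i)))"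
    by (simp add: sum_distrib_right)
  also have "\<dots> = (\<Sum>i<k. \<Sum>\<zeta>::complex | \<zeta> ^ k = 1. z ^ i * \<zeta> ^ (m + (k - Suc i)))" by (rule sum.swap)
  also have "\<dots> = (\<Sum>i<k. if i = m - 1 then z ^ (m - 1) * of_nat k else 0)"
  proof (rule sum.cong[OF refl])
    fix i assume i: "i \<in> {..<k}"
    have "k dvd m + (k - Suc i) \<longleftrightarrow> i = m - 1"
    proof
      assume "k dvd m + (k - Suc i)"
      then obtain c where c: "m + (k - Suc i) = k * c" by auto
      have "c = 1"
      proof (rule ccontr)
        assume "c \<noteq> 1"
        then have "c = 0 \<or> c \<ge> 2" by linarith
        moreover have "c \<noteq> 0" using c m by (intro notI) simp
        ultimately have "k * 2 \<le> k * c" by simp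
        then show False using c m i unfolding lessThan_iff by linarith
      qed
      then show "i = m - 1" using c m i by simp
    qed (use m in simp)
    then show "(\<Sum>\<zeta>::complex | \<zeta> ^ k = 1. z ^ i * \<zeta> ^ (m + (k - Suc i))) = (if i = m - 1 then z ^ (m - 1) * of_nat k else 0)"
      using sum_powers_roots_of_unity[OF k, of "m + (k - Suc i)"] by (simp flip: sum_distrib_left)
  qed
  also have "\<dots> = of_nat k * z ^ (m - 1)" using m by simp
  finally show ?thesis using z by (simp add: field_simps)
qed

lemma cnj_root_of_unity:
  assumes "\<zeta> ^ k = 1" "k > 0"
  shows "cnj \<zeta> = \<zeta> ^ (k - 1)" "norm \<zeta> = 1"
proof -
  have "norm \<zeta> ^ k = 1" using assms by (metis norm_one norm_power)
  then show n: "norm \<zeta> = 1" using assms(2) power_eq_imp_eq_base[of "norm \<zeta>" k 1] by simp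
  have "\<zeta> * cnj \<zeta> = 1" using complex_norm_square[of \<zeta>] n by simp
  moreover have "\<zeta> * \<zeta> ^ (k - 1) = 1" using assms power_minus_mult[of k \<zeta>] by (simp add: mult.commute)
  moreover have "\<zeta> \<noteq> 0" using n by auto
  ultimately show "cnj \<zeta> = \<zeta> ^ (k - 1)" by (metis mult_left_cancel)
qed

text \<open>
  In the three identities \<open>u\<close> stands for \<open>z ^ k\<close> and \<open>K\<close> for \<open>k\<close>. They express \<open>dh / G\<close>, \<open>G dh\<close> and \<open>dh\<close> as
  the derivative of a rational function plus the closed form of a sum of simple fractions.
\<close>
lemma primitive_identity_A:
  fixes z u r K :: complex
  assumes "z \<noteq> 0" "u \<noteq> 1" "r \<noteq> 0" "K \<noteq> 0"
  shows "1 / (r * K) * (- ((K + 1) * u - 1) / (z * (u - 1))\<^sup>2 - (K + 1) / z\<^sup>2)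
      + (K + 1) / (r * K\<^sup>2) * (K * (u / z\<^sup>2) / (u - 1)) = - 1 / (r * z\<^sup>2 * (u - 1)\<^sup>2)"
proof -
  define v where "v = u - 1"
  have v: "v \<noteq> 0" "u = v + 1" using assms by (auto simp: v_def)
  have "1 / (r * K) * (- ((K + 1) * (v + 1) - 1) / (z * v)\<^sup>2 - (K + 1) / z\<^sup>2)
      + (K + 1) / (r * K\<^sup>2) * (K * ((v + 1) / z\<^sup>2) / v) = - 1 / (r * z\<^sup>2 * v\<^sup>2)"
    using assms v(1) by (simp add: divide_simps power2_eq_square) algebra
  then show ?thesis using v by simp
qed

lemma primitive_identity_B:
  fixes u r K b :: complex
  assumes "u \<noteq> 1" "K \<noteq> 0"
  shows "- r * (1 - (1 - b)\<^sup>2 / K * ((u - 1) - K * u) / (u - 1)\<^sup>2)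
      - r * (1 - b) * (K + 1 + b * (K - 1)) / K\<^sup>2 * (K / (u - 1)) = - r * (u - b)\<^sup>2 / (u - 1)\<^sup>2"
proof -
  define v where "v = u - 1"
  have v: "v \<noteq> 0" "u = v + 1" using assms by (auto simp: v_def)
  have "- r * (1 - (1 - b)\<^sup>2 / K * (v - K * (v + 1)) / v\<^sup>2)
      - r * (1 - b) * (K + 1 + b * (K - 1)) / K\<^sup>2 * (K / v) = - r * (v + 1 - b)\<^sup>2 / v\<^sup>2"
    using assms v(1) by (simp add: divide_simps power2_eq_square) algebra
  then show ?thesis using v by simp
qed

lemma primitive_identity_h:
  fixes z u K b :: complex
  assumes "z \<noteq> 0" "u \<noteq> 1" "K \<noteq> 0"
  shows "(1 - b) / K * (- (K * (u / z)) / (u - 1)\<^sup>2) + b / z - b / K * (K * (u / z) / (u - 1))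
      = (b - u) / (z * (u - 1)\<^sup>2)"
proof -
  define v where "v = u - 1"
  have v: "v \<noteq> 0" "u = v + 1" using assms by (auto simp: v_def)
  have "(1 - b) / K * (- (K * ((v + 1) / z)) / v\<^sup>2) + b / z - b / K * (K * ((v + 1) / z) / v)
      = (b - (v + 1)) / (z * v\<^sup>2)"
    using assms v(1) by (simp add: divide_simps power2_eq_square) algebra
  then show ?thesis using v by simp
qed

section \<open>Null vectors and the Gauss map\<close>

text \<open>
  The integrand of the Weierstrass representation, written in terms of \<open>A = dh / G\<close>, \<open>B = G dh\<close> and
  \<open>C = dh\<close>. It is null exactly because \<open>A * B = C\<^sup>2\<close>.
\<close>
definition weierstrass_vector :: "complex \<Rightarrow> complex \<Rightarrow> complex \<Rightarrow> 3 \<Rightarrow> complex" where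
  "weierstrass_vector A B C j = (vector [(A - B) / 2, \<i> * (A + B) / 2, C] :: complex ^ 3) $ j"

lemma weierstrass_vector_divide: "weierstrass_vector A B C j / w = weierstrass_vector (A / w) (B / w) (C / w) j"
  using exhaust_3[of j] by (auto simp: weierstrass_vector_def diff_divide_distrib add_divide_distrib distrib_left mult.commute)

lemma weierstrass_vector_analytic:
  assumes "A analytic_on S" "B analytic_on S" "C analytic_on S"
  shows "(\<lambda>w. weierstrass_vector (A w) (B w) (C w) j) analytic_on S"
  using exhaust_3[of j] by (auto simp: weierstrass_vector_def intro!: analytic_intros assms)

lemma weierstrass_vector_null:
  "(\<Sum>j\<in>UNIV. (weierstrass_vector A B C j)\<^sup>2) = C\<^sup>2 - A * B"
  by (simp add: sum_3 weierstrass_vector_def power_divide power_mult_distrib)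
     (simp add: power2_eq_square field_simps)

lemma norm_inv_stereographic: "norm (inv_stereographic q) = 1"
proof (cases q)
  case None
  then show ?thesis by (simp add: norm_eq_sqrt_inner inner_vec_def sum_3)
next
  case (Some g)
  define D where "D = (norm g)\<^sup>2 + 1"
  have D: "D > 0" by (simp add: D_def add_nonneg_pos)
  have "inv_stereographic q \<bullet> inv_stereographic q = (2 * Re g / D)\<^sup>2 + (2 * Im g / D)\<^sup>2 + (((norm g)\<^sup>2 - 1) / D)\<^sup>2"
    unfolding Some inner_vec_def sum_3 power2_eq_square[of "_ / _"]
    by (simp add: D_def)
  also have "\<dots> = ((2 * Re g)\<^sup>2 + (2 * Im g)\<^sup>2 + ((norm g)\<^sup>2 - 1)\<^sup>2) / D\<^sup>2"
    by (simp only: power_divide add_divide_distrib)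
  also have "(2 * Re g)\<^sup>2 + (2 * Im g)\<^sup>2 + ((norm g)\<^sup>2 - 1)\<^sup>2 = D\<^sup>2"
    unfolding D_def cmod_power2 by algebra
  finally show ?thesis using D by (simp add: norm_eq_1)
qed

text \<open>
  The arguments \<open>\<sigma>\<close>, \<open>\<sigma> g\<^sup>2\<close>, \<open>\<sigma> g\<close> are the general values of \<open>dh / G\<close>, \<open>G dh\<close>, \<open>dh\<close> at a point where
  \<open>G = g\<close>: the tangent vectors of the surface are orthogonal to the normal given by the Gauss map.
\<close>
lemma weierstrass_vector_orthogonal_normal:
  "(\<Sum>j\<in>UNIV. weierstrass_vector \<sigma> (\<sigma> * g\<^sup>2) (\<sigma> * g) j * of_real (inv_stereographic (Some g) $ j)) = 0"
proof -
  define D where "D = (norm g)\<^sup>2 + 1"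
  have "D > 0" by (simp add: D_def add_nonneg_pos)
  define x y where "x = complex_of_real (Re g)" and "y = complex_of_real (Im g)"
  have g: "g = x + \<i> * y" by (simp add: x_def y_def complex_eq)
  have n: "complex_of_real ((norm g)\<^sup>2) = x\<^sup>2 + y\<^sup>2"
    by (simp add: cmod_power2 x_def y_def)
  define d where "d = complex_of_real D"
  have d: "d \<noteq> 0" using \<open>D > 0\<close> by (simp add: d_def)
  have "of_real (inv_stereographic (Some g) $ 1) = 2 * x / d" "of_real (inv_stereographic (Some g) $ 2) = 2 * y / d"
    "of_real (inv_stereographic (Some g) $ 3) = (of_real ((norm g)\<^sup>2) - 1) / d"
    by (simp_all add: x_def y_def d_def D_def)
  then have "(\<Sum>j\<in>UNIV. weierstrass_vector \<sigma> (\<sigma> * g\<^sup>2) (\<sigma> * g) j * of_real (inv_stereographic (Some g) $ j))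
     = (\<sigma> - \<sigma> * g\<^sup>2) / 2 * (2 * x / d) + \<i> * (\<sigma> + \<sigma> * g\<^sup>2) / 2 * (2 * y / d) + \<sigma> * g * ((of_real ((norm g)\<^sup>2) - 1) / d)"
    by (simp only: sum_3 weierstrass_vector_def vector_3)
  also have "\<dots> = \<sigma> / d * ((1 - g\<^sup>2) * x + \<i> * (1 + g\<^sup>2) * y + g * (of_real ((norm g)\<^sup>2) - 1))"
    using d by (simp add: field_simps)
  also have "(1 - g\<^sup>2) * x + \<i> * (1 + g\<^sup>2) * y + g * (of_real ((norm g)\<^sup>2) - 1) = 0"
  proof -
    have "\<i> * \<i> = -1" by simp
    then show ?thesis unfolding n unfolding g by algebra
  qed
  finally show ?thesis by simp
qed

section \<open>The coordinate functions of the surface\<close>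

lemma eventually_avoids_finite:
  assumes "finite A"
  shows "\<forall>\<^sub>F w in at 0. (z :: complex) + w \<notin> A" "\<forall>\<^sub>F w in at 0. w \<noteq> 0 \<and> 1 / (w :: complex) \<notin> A"
proof -
  have "\<forall>\<^sub>F w in at 0. w \<noteq> x - z" for x
    using eventually_neq_at_within[of "x - z" 0 UNIV] .
  then have "\<forall>\<^sub>F w in at 0. \<forall>x\<in>A. w \<noteq> x - z" by (intro eventually_ball_finite assms) auto
  then show "\<forall>\<^sub>F w in at 0. z + w \<notin> A" by (rule eventually_mono) auto
  have "\<forall>\<^sub>F w in at 0. w \<noteq> 1 / (x::complex)" for x
    using eventually_neq_at_within[of "1 / x" 0 UNIV] .
  then have "\<forall>\<^sub>F w in at 0. \<forall>x\<in>A. w \<noteq> 1 / x" by (intro eventually_ball_finite assms) auto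
  then show "\<forall>\<^sub>F w in at 0. w \<noteq> 0 \<and> 1 / w \<notin> A"
    using eventually_neq_at_within[of 0 0 UNIV]
    by eventually_elim auto
qed

text \<open>
  The parameter \<open>b\<close> stands for \<open>a ^ k\<close>: only this power of \<open>a\<close> enters the data.
\<close>
locale planar_catenoid_data =
  fixes k :: nat and b :: real
  assumes k: "k > 1" and b: "0 < b" "b < 1"
begin

text \<open>
  The solution of the period problem: the residues at a root of unity \<open>\<zeta>\<close> are \<open>s * cnj \<zeta>\<close> for \<open>dh / G\<close> and
  \<open>- (\<rho> * (1 - b) * (k + 1 + b * (k - 1)) / k\<^sup>2) * \<zeta>\<close> for \<open>G dh\<close>, with \<open>s = (k + 1) / (\<rho> * k\<^sup>2)\<close>. Equating the two
  coefficients determines \<open>\<rho>\<^sup>2\<close>.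
\<close>
definition \<rho> :: real where
  "\<rho> = sqrt ((real k + 1) / ((1 - b) * (real k + 1 + b * (real k - 1))))"

definition G :: "complex \<Rightarrow> complex" where
  "G z = of_real \<rho> * z * (z ^ k - of_real b)"

definition h :: "complex \<Rightarrow> complex" where
  "h z = (of_real b - z ^ k) / (z * (z ^ k - 1)\<^sup>2)"

definition Z :: "complex set" where "Z = insert 0 {z. z ^ k = 1}"

definition P :: "sphere set" where "P = {Some 0, None} \<union> Some ` {z. z ^ k = 1}"

lemma finite_Z [simp]: "finite Z" using k by (simp add: Z_def finite_roots_of_unity)

lemma P_eq: "P = insert None (Some ` Z)" by (auto simp: P_def Z_def)

lemma finite_P: "finite P" by (simp add: P_eq)

lemma None_P [simp]: "None \<in> P" by (simp add: P_eq)

lemma Some_P [simp]: "Some z \<in> P \<longleftrightarrow> z \<in> Z" by (auto simp: P_eq)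

lemma plane_part_P: "plane_part P = - Z" by (auto simp: plane_part_def)

lemma notin_Z: "z \<notin> Z \<longleftrightarrow> z \<noteq> 0 \<and> z ^ k \<noteq> 1" by (auto simp: Z_def)

lemma pos_sum: "real k + 1 + b * (real k - 1) > 0"
  using k b by (intro add_pos_nonneg) auto

lemma \<rho>_pos: "\<rho> > 0"
  unfolding \<rho>_def using b k pos_sum by (intro real_sqrt_gt_zero divide_pos_pos mult_pos_pos) auto

lemma \<rho>_sq: "\<rho>\<^sup>2 * ((1 - b) * (real k + 1 + b * (real k - 1))) = real k + 1"
proof -
  have nz: "(1 - b) * (real k + 1 + b * (real k - 1)) > 0" using b pos_sum by simp
  then have "\<rho>\<^sup>2 = (real k + 1) / ((1 - b) * (real k + 1 + b * (real k - 1)))"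
    unfolding \<rho>_def by (intro real_sqrt_pow2 divide_nonneg_pos) auto
  then show ?thesis using pos_sum b by simp
qed

definition s :: real where "s = (real k + 1) / (\<rho> * (real k)\<^sup>2)"

text \<open>
  Here the choice of \<open>\<rho>\<close> enters the period problem: the moduli of the two residues agree.
\<close>
lemma s_alt: "s = \<rho> * (1 - b) * (real k + 1 + b * (real k - 1)) / (real k)\<^sup>2"
proof -
  define x where "x = \<rho> * (1 - b) * (real k + 1 + b * (real k - 1))"
  have "real k + 1 = \<rho> * x"
    using \<rho>_sq by (simp add: x_def power2_eq_square mult_ac)
  then have "s = x / (real k)\<^sup>2" using \<rho>_pos by (simp add: s_def)
  then show ?thesis by (simp only: x_def)
qed

text \<open>
  The form \<open>dh / G\<close> after cancellation. At a zero of \<open>G\<close> in the surface \<open>1 / G\<close> is \<open>1 / 0 = 0\<close>, and \<open>1 / G z * h z\<close> misses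
  the nonzero limit that is the value of this form.
\<close>
definition A_form :: "complex \<Rightarrow> complex" where
  "A_form z = - 1 / (of_real \<rho> * z\<^sup>2 * (z ^ k - 1)\<^sup>2)"

definition B_form :: "complex \<Rightarrow> complex" where
  "B_form z = - of_real \<rho> * (z ^ k - of_real b)\<^sup>2 / (z ^ k - 1)\<^sup>2"

lemma A_form_eq: "z \<notin> Z \<Longrightarrow> z ^ k \<noteq> of_real b \<Longrightarrow> 1 / G z * h z = A_form z"
  using \<rho>_pos by (simp add: notin_Z G_def h_def A_form_def divide_simps) algebra

lemma B_form_eq: "z \<notin> Z \<Longrightarrow> G z * h z = B_form z"
  by (simp add: notin_Z G_def h_def B_form_def divide_simps power2_eq_square) algebra

definition coord_form :: "3 \<Rightarrow> complex \<Rightarrow> complex" where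
  "coord_form j z = weierstrass_vector (A_form z) (B_form z) (h z) j"

text \<open>
  The rational parts of the primitives of \<open>dh / G\<close>, \<open>G dh\<close> and \<open>dh\<close>.
\<close>
definition QA :: "complex \<Rightarrow> complex" where
  "QA z = 1 / (of_real \<rho> * of_nat k) * (1 / (z * (z ^ k - 1)) + (of_nat k + 1) / z)"

definition QB :: "complex \<Rightarrow> complex" where
  "QB z = - of_real \<rho> * (z - (1 - of_real b)\<^sup>2 / of_nat k * (z / (z ^ k - 1)))"

definition Qh :: "complex \<Rightarrow> complex" where
  "Qh z = (1 - of_real b) / of_nat k * (1 / (z ^ k - 1))"

definition rational_part :: "3 \<Rightarrow> complex \<Rightarrow> complex" where
  "rational_part j z = weierstrass_vector (QA z) (QB z) (Qh z) j"

text \<open>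
  With residues \<open>s * cnj \<zeta>\<close> of \<open>dh / G\<close> and \<open>- s * \<zeta>\<close> of \<open>G dh\<close>, half their difference is \<open>s * Re \<zeta>\<close> and
  \<open>\<i> / 2\<close> times their sum is \<open>s * Im \<zeta>\<close>. At \<open>0\<close> both expressions vanish, as they should: there only \<open>dh\<close> has a residue.
\<close>
definition log_coeff :: "3 \<Rightarrow> complex \<Rightarrow> real" where
  "log_coeff j \<xi> = (vector [s * Re \<xi>, s * Im \<xi>, if \<xi> = 0 then b else - b / real k] :: real ^ 3) $ j"

definition \<Psi> :: "3 \<Rightarrow> complex \<Rightarrow> real" where
  "\<Psi> j = log_potential Z (log_coeff j) (rational_part j)"

lemma power_k: "z ^ (k - 2) * z\<^sup>2 = (z :: complex) ^ k" "z ^ (k - 1) * z = (z :: complex) ^ k"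
proof -
  have "k - 2 + 2 = k" using k by simp
  then show "z ^ (k - 2) * z\<^sup>2 = z ^ k" by (metis power_add)
  show "z ^ (k - 1) * z = z ^ k" using power_minus_mult[of k z] k by simp
qed

lemma QA_deriv:
  assumes "z \<notin> Z"
  shows "(QA has_field_derivative (A_form z - of_real s * (of_nat k * z ^ (k - 2) / (z ^ k - 1)))) (at z)"
proof -
  have z: "z \<noteq> 0" "z ^ k \<noteq> 1" using assms by (auto simp: notin_Z)
  have "(QA has_field_derivative 1 / (of_real \<rho> * of_nat k) *
      (- (1 * (z ^ k - 1) + z * (of_nat k * z ^ (k - 1))) / (z * (z ^ k - 1))\<^sup>2 - (of_nat k + 1) / z\<^sup>2)) (at z)"
    unfolding QA_def using z \<rho>_pos k
    by (auto intro!: derivative_eq_intros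
        simp: power2_eq_square mult_ac diff_divide_distrib add_divide_distrib)
  then show ?thesis
  proof (rule DERIV_cong)
    have num: "1 * (z ^ k - 1) + z * (of_nat k * z ^ (k - 1)) = (of_nat k + 1) * z ^ k - 1"
      using power_k(2)[of z] by (simp add: algebra_simps)
    have pow: "of_nat k * z ^ (k - 2) / (z ^ k - 1) = of_nat k * (z ^ k / z\<^sup>2) / (z ^ k - 1)"
      using power_k(1)[of z] z by (simp add: field_simps)
    have s: "of_real s = (of_nat k + 1) / (of_real \<rho> * (of_nat k)\<^sup>2 :: complex)" by (simp add: s_def)
    show "1 / (of_real \<rho> * of_nat k) * (- (1 * (z ^ k - 1) + z * (of_nat k * z ^ (k - 1))) / (z * (z ^ k - 1))\<^sup>2
        - (of_nat k + 1) / z\<^sup>2) = A_form z - of_real s * (of_nat k * z ^ (k - 2) / (z ^ k - 1))"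
      unfolding num pow s eq_diff_eq A_form_def
      by (rule primitive_identity_A) (use z \<rho>_pos k in auto)
  qed
qed

lemma QB_deriv:
  assumes "z \<notin> Z"
  shows "(QB has_field_derivative (B_form z + of_real s * (of_nat k / (z ^ k - 1)))) (at z)"
proof -
  have z: "z \<noteq> 0" "z ^ k \<noteq> 1" using assms by (auto simp: notin_Z)
  have "((\<lambda>z. z / (z ^ k - 1)) has_field_derivative
      (1 * (z ^ k - 1) - z * (of_nat k * z ^ (k - 1))) / (z ^ k - 1)\<^sup>2) (at z)"
    using z by (auto intro!: derivative_eq_intros simp: power2_eq_square[of "z ^ k - 1"])
  then have "(QB has_field_derivative - of_real \<rho> * (1 - (1 - of_real b)\<^sup>2 / of_nat k *
      ((1 * (z ^ k - 1) - z * (of_nat k * z ^ (k - 1))) / (z ^ k - 1)\<^sup>2))) (at z)"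
    unfolding QB_def by (intro DERIV_cmult DERIV_diff DERIV_ident)
  then show ?thesis
  proof (rule DERIV_cong)
    have num: "1 * (z ^ k - 1) - z * (of_nat k * z ^ (k - 1)) = (z ^ k - 1) - of_nat k * z ^ k"
      using power_k(2)[of z] by (simp add: algebra_simps)
    have s: "of_real s = of_real \<rho> * (1 - of_real b) * (of_nat k + 1 + of_real b * (of_nat k - 1)) / (of_nat k :: complex)\<^sup>2"
      by (simp add: s_alt)
    show "- of_real \<rho> * (1 - (1 - of_real b)\<^sup>2 / of_nat k * ((1 * (z ^ k - 1) - z * (of_nat k * z ^ (k - 1)))
        / (z ^ k - 1)\<^sup>2)) = B_form z + of_real s * (of_nat k / (z ^ k - 1))"
      unfolding num s diff_eq_eq[symmetric] B_form_def
        times_divide_eq_right[of "(1 - of_real b)\<^sup>2 / of_nat k" "z ^ k - 1 - of_nat k * z ^ k"]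
      by (rule primitive_identity_B) (use z k in auto)
  qed
qed

lemma Qh_deriv:
  assumes "z \<notin> Z"
  shows "(Qh has_field_derivative (h z - of_real b / z + of_real b / of_nat k * (of_nat k * z ^ (k - 1) / (z ^ k - 1)))) (at z)"
proof -
  have z: "z \<noteq> 0" "z ^ k \<noteq> 1" using assms by (auto simp: notin_Z)
  have "(Qh has_field_derivative (1 - of_real b) / of_nat k *
      (- (of_nat k * z ^ (k - 1)) / (z ^ k - 1)\<^sup>2)) (at z)"
    unfolding Qh_def using z
    by (auto intro!: derivative_eq_intros simp: power2_eq_square)
  then show ?thesis
  proof (rule DERIV_cong)
    have pow: "of_nat k * z ^ (k - 1) = of_nat k * (z ^ k / z)"
      using power_k(2)[of z] z by (simp add: field_simps)
    have rearrange: "x = v - y + w" if "x + y - w = v" for x y v w :: complex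
      using that by (auto simp: algebra_simps)
    show "(1 - of_real b) / of_nat k * (- (of_nat k * z ^ (k - 1)) / (z ^ k - 1)\<^sup>2)
        = h z - of_real b / z + of_real b / of_nat k * (of_nat k * z ^ (k - 1) / (z ^ k - 1))"
      unfolding pow h_def
      by (rule rearrange, rule primitive_identity_h) (use z k in auto)
  qed
qed

lemma sum_Z: "(\<Sum>\<xi>\<in>Z. f \<xi>) = f 0 + (\<Sum>\<zeta> | \<zeta> ^ k = 1. f \<zeta>)"
  unfolding Z_def using k finite_roots_of_unity[of k] by (subst sum.insert) (auto simp: power_0_left)

text \<open>
  The weights are \<open>Re \<zeta> = (cnj \<zeta> + \<zeta>) / 2\<close>, \<open>Im \<zeta> = \<i> / 2 * (cnj \<zeta> - \<zeta>)\<close> and a constant, with \<open>cnj \<zeta> = \<zeta> ^ (k - 1)\<close>,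
  so partial fractions with the exponents \<open>1\<close>, \<open>k - 1\<close> and \<open>k\<close> give closed forms.
\<close>
lemma log_sums:
  assumes "z \<notin> Z"
  defines "U \<equiv> of_nat k / (z ^ k - 1)" and "V \<equiv> of_nat k * z ^ (k - 2) / (z ^ k - 1)"
  shows "(\<Sum>\<xi>\<in>Z. of_real (log_coeff 1 \<xi>) / (z - \<xi>)) = of_real s * (V + U) / 2"
    "(\<Sum>\<xi>\<in>Z. of_real (log_coeff 2 \<xi>) / (z - \<xi>)) = \<i> * of_real s * (V - U) / 2"
    "(\<Sum>\<xi>\<in>Z. of_real (log_coeff 3 \<xi>) / (z - \<xi>)) = of_real b / z - of_real b / of_nat k * (of_nat k * z ^ (k - 1) / (z ^ k - 1))"
proof -
  have z: "z \<noteq> 0" "z ^ k \<noteq> 1" using assms by (auto simp: notin_Z)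
  have U: "(\<Sum>\<zeta> | \<zeta> ^ k = 1. \<zeta> / (z - \<zeta>)) = U"
    using partial_fractions_roots_of_unity[of 1 k z] z k by (simp add: U_def)
  have "(\<Sum>\<zeta> | \<zeta> ^ k = 1. cnj \<zeta> / (z - \<zeta>)) = (\<Sum>\<zeta> | \<zeta> ^ k = 1. \<zeta> ^ (k - 1) / (z - \<zeta>))"
    by (rule sum.cong) (use k cnj_root_of_unity(1) in auto)
  also have "\<dots> = V"
    using partial_fractions_roots_of_unity[of "k - 1" k z] z k by (simp add: V_def numeral_2_eq_2)
  finally have V: "(\<Sum>\<zeta> | \<zeta> ^ k = 1. cnj \<zeta> / (z - \<zeta>)) = V" .
  have sums: "(\<Sum>\<xi>\<in>Z. \<xi> / (z - \<xi>)) = U" "(\<Sum>\<xi>\<in>Z. cnj \<xi> / (z - \<xi>)) = V"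
    using U V by (simp_all add: sum_Z)
  have L1: "of_real (log_coeff 1 \<xi>) / (z - \<xi>) = of_real s / 2 * (cnj \<xi> / (z - \<xi>) + \<xi> / (z - \<xi>))" for \<xi>
  proof -
    have "of_real (log_coeff 1 \<xi>) = of_real s / 2 * (cnj \<xi> + \<xi>)"
      by (simp add: log_coeff_def complex_eq_iff)
    then show ?thesis by (simp only: times_divide_eq_right add_divide_distrib distrib_left)
  qed
  show "(\<Sum>\<xi>\<in>Z. of_real (log_coeff 1 \<xi>) / (z - \<xi>)) = of_real s * (V + U) / 2"
    unfolding L1 sum_distrib_left[symmetric] sum.distrib sums by simp
  have L2: "of_real (log_coeff 2 \<xi>) / (z - \<xi>) = \<i> * of_real s / 2 * (cnj \<xi> / (z - \<xi>) - \<xi> / (z - \<xi>))" for \<xi>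
  proof -
    have "of_real (log_coeff 2 \<xi>) = \<i> * of_real s / 2 * (cnj \<xi> - \<xi>)"
      by (simp add: log_coeff_def complex_eq_iff)
    then show ?thesis by (simp only: times_divide_eq_right diff_divide_distrib right_diff_distrib)
  qed
  show "(\<Sum>\<xi>\<in>Z. of_real (log_coeff 2 \<xi>) / (z - \<xi>)) = \<i> * of_real s * (V - U) / 2"
    unfolding L2 sum_distrib_left[symmetric] sum_subtractf sums by simp
  have "(\<Sum>\<zeta> | \<zeta> ^ k = 1. of_real (log_coeff 3 \<zeta>) / (z - \<zeta>))
      = (\<Sum>\<zeta> | \<zeta> ^ k = 1. (- of_real b / of_nat k) * (\<zeta> ^ k / (z - \<zeta>)))"
    by (rule sum.cong) (use k in \<open>auto simp: log_coeff_def power_0_left\<close>)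
  also have "\<dots> = (- of_real b / of_nat k) * (of_nat k * z ^ (k - 1) / (z ^ k - 1))"
    unfolding sum_distrib_left[symmetric]
    using partial_fractions_roots_of_unity[of k k z] z k by simp
  finally show "(\<Sum>\<xi>\<in>Z. of_real (log_coeff 3 \<xi>) / (z - \<xi>)) = of_real b / z - of_real b / of_nat k * (of_nat k * z ^ (k - 1) / (z ^ k - 1))"
    unfolding sum_Z by (simp add: log_coeff_def)
qed

lemma \<Psi>_has_derivative:
  assumes "z \<notin> Z"
  shows "(\<Psi> j has_derivative (\<lambda>v. Re (coord_form j z * v))) (at z)"
proof -
  define U V :: complex where "U = of_nat k / (z ^ k - 1)" and "V = of_nat k * z ^ (k - 2) / (z ^ k - 1)"
  note sums = log_sums[OF assms, folded U_def V_def]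
  note A = QA_deriv[OF assms, folded V_def] and B = QB_deriv[OF assms, folded U_def]
  have "(rational_part 1 has_field_derivative ((A_form z - of_real s * V) - (B_form z + of_real s * U)) / 2) (at z)"
    unfolding rational_part_def weierstrass_vector_def vector_3 by (intro DERIV_cdivide DERIV_diff A B)
  from log_potential_has_derivative[OF finite_Z assms this, of "log_coeff 1"] have 1: ?thesis if "j = 1"
    unfolding sums \<Psi>_def that by (simp add: coord_form_def weierstrass_vector_def algebra_simps diff_divide_distrib add_divide_distrib)
  have "(rational_part 2 has_field_derivative (\<i> * ((A_form z - of_real s * V) + (B_form z + of_real s * U))) / 2) (at z)"
    unfolding rational_part_def weierstrass_vector_def vector_3 by (intro DERIV_cdivide DERIV_cmult DERIV_add A B)
  from log_potential_has_derivative[OF finite_Z assms this, of "log_coeff 2"] have 2: ?thesis if "j = 2"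
    unfolding sums \<Psi>_def that by (simp add: coord_form_def weierstrass_vector_def algebra_simps diff_divide_distrib add_divide_distrib)
  have "(rational_part 3 has_field_derivative (h z - of_real b / z + of_real b / of_nat k * (of_nat k * z ^ (k - 1) / (z ^ k - 1)))) (at z)"
    unfolding rational_part_def weierstrass_vector_def vector_3 by (rule Qh_deriv[OF assms])
  from log_potential_has_derivative[OF finite_Z assms this, of "log_coeff 3"] have 3: ?thesis if "j = 3"
    unfolding sums \<Psi>_def that by (simp add: coord_form_def weierstrass_vector_def)
  show ?thesis using 1 2 3 exhaust_3[of j] by blast
qed

end

context planar_catenoid_data begin

text \<open>
  The three integrands before cancellation; they differ from \<^term>\<open>coord_form\<close> at the zeros of \<open>G\<close>, where
  \<open>1 / G\<close> has the value \<open>0\<close>.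
\<close>
definition raw_form :: "3 \<Rightarrow> complex \<Rightarrow> complex" where
  "raw_form j z = (vector [1 / 2 * (1 / G z - G z) * h z, \<i> / 2 * (1 / G z + G z) * h z, h z] :: complex ^ 3) $ j"

lemma finite_zeros: "finite {z::complex. z ^ k = of_real b}"
  using k b by (intro finite_nth_roots) auto

lemma raw_form_eq:
  assumes "z \<notin> Z" "z ^ k \<noteq> of_real b"
  shows "raw_form j z = coord_form j z"
proof -
  have "1 / 2 * (p - q) * r = (p * r - q * r) / 2" "\<i> / 2 * (p + q) * r = \<i> * (p * r + q * r) / 2" for p q r :: complex
    by (simp_all add: algebra_simps)
  then have "raw_form j z = weierstrass_vector (1 / G z * h z) (G z * h z) (h z) j"
    unfolding raw_form_def weierstrass_vector_def by (simp only:)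
  then show ?thesis unfolding A_form_eq[OF assms] B_form_eq[OF assms(1)] coord_form_def .
qed

lemma forms_analytic:
  assumes "S \<inter> Z = {}"
  shows "A_form analytic_on S" "B_form analytic_on S" "h analytic_on S" "coord_form j analytic_on S"
proof -
  have nz: "z \<noteq> 0 \<and> z ^ k \<noteq> 1" if "z \<in> S" for z using that assms notin_Z by blast
  show A: "A_form analytic_on S" unfolding A_form_def[abs_def]
    by (intro analytic_intros) (use nz \<rho>_pos in auto)
  show B: "B_form analytic_on S" unfolding B_form_def[abs_def]
    by (intro analytic_intros) (use nz in auto)
  show C: "h analytic_on S" unfolding h_def[abs_def]
    by (intro analytic_intros) (use nz in auto)
  show "coord_form j analytic_on S" unfolding coord_form_def[abs_def]
    by (intro weierstrass_vector_analytic A B C)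
qed

lemma remove_sings_raw_form:
  assumes "z \<notin> Z"
  shows "remove_sings (local_form (raw_form j) (Some z)) 0 = coord_form j z"
proof (rule remove_sings_eqI)
  have "isCont (coord_form j) z"
    using forms_analytic(4)[of "{z}"] assms analytic_at_imp_isCont by blast
  then have "((\<lambda>w. coord_form j (z + w)) \<longlongrightarrow> coord_form j z) (at 0)"
    by (simp add: isCont_def LIM_offset_zero_iff[of z])
  moreover have "\<forall>\<^sub>F w in at 0. z + w \<notin> Z \<union> {x. x ^ k = of_real b}"
    by (rule eventually_avoids_finite) (use finite_zeros in auto)
  then have "\<forall>\<^sub>F w in at 0. coord_form j (z + w) = local_form (raw_form j) (Some z) w"
    by (rule eventually_mono) (auto simp: raw_form_eq)
  ultimately show "local_form (raw_form j) (Some z) \<midarrow>0\<rightarrow> coord_form j z"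
    by (rule Lim_transform_eventually)
qed

lemma weierstrass_integral_component:
  "weierstrass_integral G h \<gamma> $ j = Re (form_integral (raw_form j) \<gamma>)"
proof -
  have "raw_form 1 = (\<lambda>z. 1 / 2 * (1 / G z - G z) * h z)" "raw_form 2 = (\<lambda>z. \<i> / 2 * (1 / G z + G z) * h z)"
    "raw_form 3 = h"
    by (simp_all add: raw_form_def fun_eq_iff)
  then show ?thesis using exhaust_3[of j] by (auto simp: weierstrass_integral_def)
qed

text \<open>
  The integral depends on the end points only; the period condition is the case of a closed curve.
\<close>
lemma weierstrass_integral_eq:
  assumes "sphere_curve P \<gamma>"
  obtains x y where "\<gamma> 0 = Some x" "\<gamma> 1 = Some y" "\<And>j. weierstrass_integral G h \<gamma> $ j = \<Psi> j y - \<Psi> j x"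
proof -
  obtain g where g: "\<And>t. t \<in> {0..1} \<Longrightarrow> \<gamma> t = Some (g t)" "valid_path g" "path_image g \<subseteq> plane_part P"
    using sphere_curve_planar_lift[OF assms None_P] by blast
  have "weierstrass_integral G h \<gamma> $ j = \<Psi> j (g 1) - \<Psi> j (g 0)" for j
  proof -
    have "coord_form j holomorphic_on plane_part P"
      using forms_analytic(4)[of "- Z"] analytic_imp_holomorphic by (simp add: plane_part_P)
    then obtain i where i: "(coord_form j has_contour_integral i) g" "Re i = \<Psi> j (pathfinish g) - \<Psi> j (pathstart g)"
      by (rule Re_contour_integral_of_real_primitive[OF g(2,3) open_plane_part[OF finite_P], of _ "\<Psi> j"])
         (use \<Psi>_has_derivative in \<open>auto simp: plane_part_P\<close>)
    have "form_integral (raw_form j) \<gamma> = i"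
      by (rule form_integral_eq_contour_integral[OF g(1) _ i(1)])
         (use g(3) remove_sings_raw_form in \<open>auto simp: plane_part_P\<close>)
    then show ?thesis using i(2) by (simp add: weierstrass_integral_component pathfinish_def pathstart_def)
  qed
  then show thesis using that[of "g 0" "g 1"] g(1) by simp
qed

lemma period: "period_condition G h P"
  unfolding period_condition_def
proof (intro allI impI)
  fix \<gamma> assume \<gamma>: "sphere_curve P \<gamma> \<and> \<gamma> 0 = \<gamma> 1"
  then obtain x y where "\<gamma> 0 = Some x" "\<gamma> 1 = Some y" "\<And>j. weierstrass_integral G h \<gamma> $ j = \<Psi> j y - \<Psi> j x"
    using weierstrass_integral_eq by metis
  with \<gamma> show "weierstrass_integral G h \<gamma> = 0" by (simp add: vec_eq_iff)
qed

lemma weierstrass_map_eq: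
  assumes "x \<notin> Z" "y \<notin> Z"
  shows "weierstrass_map G h P (Some x) (Some y) $ j = \<Psi> j y - \<Psi> j x"
proof -
  define \<gamma> where "\<gamma> = (SOME \<gamma>. sphere_curve P \<gamma> \<and> \<gamma> 0 = Some x \<and> \<gamma> 1 = Some y)"
  have "\<exists>\<gamma>. sphere_curve P \<gamma> \<and> \<gamma> 0 = Some x \<and> \<gamma> 1 = Some y"
    using exists_sphere_curve[OF finite_P] assms by simp
  then have \<gamma>: "sphere_curve P \<gamma> \<and> \<gamma> 0 = Some x \<and> \<gamma> 1 = Some y"
    unfolding \<gamma>_def by (rule someI_ex)
  then obtain x' y' where "\<gamma> 0 = Some x'" "\<gamma> 1 = Some y'" "weierstrass_integral G h \<gamma> $ j = \<Psi> j y' - \<Psi> j x'"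
    using weierstrass_integral_eq by metis
  with \<gamma> show ?thesis by (simp add: weierstrass_map_def \<gamma>_def[symmetric])
qed

lemma map_expansion_at_point:
  assumes "x \<notin> Z" "p \<in> Z" "q analytic_on {0}" "\<forall>\<^sub>F w in at 0. rational_part j (p + w) = q w / w"
  shows "log_pole_expansion (\<lambda>w. weierstrass_map G h P (Some x) (sphere_chart (Some p) w) $ j) (q 0) (log_coeff j p)"
proof (rule log_pole_expansion_cong)
  show "log_pole_expansion (\<lambda>w. log_potential Z (log_coeff j) (rational_part j) (p + w) + (- \<Psi> j x)) (q 0) (log_coeff j p)"
    by (intro log_pole_expansion_add_const log_potential_expansion_at_point assms finite_Z)
  show "\<forall>\<^sub>F w in at 0. log_potential Z (log_coeff j) (rational_part j) (p + w) + (- \<Psi> j x)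
      = weierstrass_map G h P (Some x) (sphere_chart (Some p) w) $ j"
    using eventually_avoids_finite(1)[OF finite_Z, of p]
    by (rule eventually_mono) (simp add: sphere_chart_def weierstrass_map_eq[OF assms(1)] \<Psi>_def)
qed

lemma map_expansion_at_infinity:
  assumes "x \<notin> Z" "q analytic_on {0}" "\<forall>\<^sub>F w in at 0. rational_part j (1 / w) = q w / w"
  shows "log_pole_expansion (\<lambda>w. weierstrass_map G h P (Some x) (sphere_chart None w) $ j) (q 0) (- (\<Sum>\<xi>\<in>Z. log_coeff j \<xi>))"
proof (rule log_pole_expansion_cong)
  show "log_pole_expansion (\<lambda>w. log_potential Z (log_coeff j) (rational_part j) (1 / w) + (- \<Psi> j x)) (q 0) (- (\<Sum>\<xi>\<in>Z. log_coeff j \<xi>))"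
    by (intro log_pole_expansion_add_const log_potential_expansion_at_infinity assms finite_Z)
  show "\<forall>\<^sub>F w in at 0. log_potential Z (log_coeff j) (rational_part j) (1 / w) + (- \<Psi> j x)
      = weierstrass_map G h P (Some x) (sphere_chart None w) $ j"
    using eventually_avoids_finite(2)[OF finite_Z]
    by (rule eventually_mono) (simp add: sphere_chart_def weierstrass_map_eq[OF assms(1)] \<Psi>_def)
qed

end

section \<open>Regularity\<close>

text \<open>
  The cofactor of \<open>w\<close> in \<open>(z + w) ^ k - z ^ k\<close>. It describes the simple zeros of \<open>z ^ k - 1\<close> and \<open>z ^ k - b\<close>.
\<close>
definition power_quotient :: "nat \<Rightarrow> complex \<Rightarrow> complex \<Rightarrow> complex" where
  "power_quotient k z w = (\<Sum>i<k. z ^ (k - Suc i) * (z + w) ^ i)"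

lemma power_quotient: "(z + w) ^ k - z ^ k = w * power_quotient k z w"
  using power_diff_sumr2[of "z + w" k z] by (simp add: power_quotient_def)

lemma power_quotient_0: "power_quotient k z 0 = of_nat k * z ^ (k - 1)"
proof -
  have "power_quotient k z 0 = (\<Sum>i<k. z ^ (k - 1))"
    unfolding power_quotient_def by (rule sum.cong) (auto simp flip: power_add)
  then show ?thesis by simp
qed

lemma power_quotient_analytic: "power_quotient k z analytic_on S"
  unfolding power_quotient_def[abs_def] by (intro analytic_intros)

lemma zorder_simple_zero:
  assumes "g analytic_on {0}" "g 0 \<noteq> 0" "\<And>w. f w = w * g w"
  shows "zorder f 0 = 1"
proof -
  obtain r where "r > 0" "g holomorphic_on ball 0 r" using assms(1) by (auto simp: analytic_on_def)
  then show ?thesis using assms(2,3) by (intro zorder_eqI[of "ball 0 r" 0 g]) auto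
qed

lemma local_representations:
  "local_fun f (Some z) = (\<lambda>w. f (z + w))" "local_fun f None = (\<lambda>w. f (1 / w))"
  "local_form f (Some z) = (\<lambda>w. f (z + w))" "local_form f None = (\<lambda>w. - f (1 / w) / w\<^sup>2)"
  by (simp_all add: fun_eq_iff)

context planar_catenoid_data begin

lemma G_nonzero: "z \<notin> insert 0 {x. x ^ k = of_real b} \<Longrightarrow> G z \<noteq> 0"
  using \<rho>_pos by (simp add: G_def)

lemma h_nonzero: "z \<notin> Z \<union> {x. x ^ k = of_real b} \<Longrightarrow> h z \<noteq> 0"
  by (auto simp: h_def notin_Z)

lemma frequently_G: "\<exists>\<^sub>F w in at 0. local_fun G p w \<noteq> 0"
proof -
  have fin: "finite (insert 0 {x::complex. x ^ k = of_real b})" using finite_zeros by simp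
  have "\<forall>\<^sub>F w in at 0. local_fun G p w \<noteq> 0"
  proof (cases p)
    case None
    show ?thesis using eventually_avoids_finite(2)[OF fin]
      by (rule eventually_mono) (simp add: None G_nonzero)
  next
    case (Some z)
    show ?thesis using eventually_avoids_finite(1)[OF fin, of z]
      by (rule eventually_mono) (simp add: Some G_nonzero)
  qed
  then show ?thesis by (rule eventually_frequently[rotated]) simp
qed

lemma frequently_h: "\<exists>\<^sub>F w in at 0. local_form h p w \<noteq> 0"
proof -
  have fin: "finite (Z \<union> {x::complex. x ^ k = of_real b})" using finite_zeros by simp
  have "\<forall>\<^sub>F w in at 0. local_form h p w \<noteq> 0"
  proof (cases p)
    case None
    show ?thesis using eventually_avoids_finite(2)[OF fin]
      by (rule eventually_mono) (simp add: None h_nonzero)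
  next
    case (Some z)
    show ?thesis using eventually_avoids_finite(1)[OF fin, of z]
      by (rule eventually_mono) (simp add: Some h_nonzero)
  qed
  then show ?thesis by (rule eventually_frequently[rotated]) simp
qed

lemma meromorphic_G: "meromorphic_function G"
  unfolding meromorphic_function_def
proof
  fix p show "local_fun G p meromorphic_on {0}"
  proof (cases p)
    case None
    have "(\<lambda>w. of_real \<rho> * (1 / w) * ((1 / w) ^ k - of_real b)) meromorphic_on {0}"
      by (intro meromorphic_intros)
    then show ?thesis by (simp add: None G_def local_representations)
  next
    case (Some z)
    have "(\<lambda>w. of_real \<rho> * (z + w) * ((z + w) ^ k - of_real b)) meromorphic_on {0}"
      by (intro meromorphic_intros)
    then show ?thesis by (simp add: Some G_def local_representations)
  qed
qed

lemma meromorphic_h: "meromorphic_form h"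
  unfolding meromorphic_form_def
proof
  fix p show "local_form h p meromorphic_on {0}"
  proof (cases p)
    case None
    have "(\<lambda>w. - ((of_real b - (1 / w) ^ k) / ((1 / w) * ((1 / w) ^ k - 1)\<^sup>2)) / w\<^sup>2) meromorphic_on {0}"
      by (intro meromorphic_intros)
    then show ?thesis unfolding None local_representations h_def .
  next
    case (Some z)
    have "(\<lambda>w. (of_real b - (z + w) ^ k) / ((z + w) * ((z + w) ^ k - 1)\<^sup>2)) meromorphic_on {0}"
      by (intro meromorphic_intros)
    then show ?thesis by (simp add: Some h_def local_representations)
  qed
qed

lemma G_analytic: "G analytic_on S"
  unfolding G_def[abs_def] by (intro analytic_intros)

lemma analytic_shift: "f analytic_on {z} \<Longrightarrow> (\<lambda>w. f (z + w)) analytic_on {0}"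
  by (rule analytic_on_compose_gen[of "\<lambda>w. z + w" "{0}" f "{z}", unfolded o_def]) (auto intro!: analytic_intros)

text \<open>
  The common zeros of \<open>G\<close> and \<open>h\<close> in the surface are the points with \<open>z ^ k = b\<close>, all of them simple.
\<close>
lemma zorder_at_regular_point:
  assumes "z \<notin> Z"
  shows "zorder (local_fun G (Some z)) 0 = (if z ^ k = of_real b then 1 else 0)"
    "zorder (local_form h (Some z)) 0 = (if z ^ k = of_real b then 1 else 0)"
proof -
  have z: "z \<noteq> 0" "z ^ k \<noteq> 1" using assms by (auto simp: notin_Z)
  have G_an: "local_fun G (Some z) analytic_on {0}" using analytic_shift[OF G_analytic, of z] by (simp add: local_representations)
  have h_an: "local_form h (Some z) analytic_on {0}"
    using analytic_shift[OF forms_analytic(3), of z] assms by (simp add: local_representations)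
  show "zorder (local_fun G (Some z)) 0 = (if z ^ k = of_real b then 1 else 0)"
  proof (cases "z ^ k = of_real b")
    case True
    have "zorder (local_fun G (Some z)) 0 = 1"
    proof (rule zorder_simple_zero)
      show "(\<lambda>w. of_real \<rho> * (z + w) * power_quotient k z w) analytic_on {0}"
        by (intro analytic_intros power_quotient_analytic)
      show "of_real \<rho> * (z + 0) * power_quotient k z 0 \<noteq> 0"
        using z \<rho>_pos k by (simp add: power_quotient_0)
      show "local_fun G (Some z) w = w * (of_real \<rho> * (z + w) * power_quotient k z w)" for w
        using power_quotient[of z w k] by (simp add: True G_def)
    qed
    with True show ?thesis by simp
  next
    case False
    then show ?thesis using z \<rho>_pos zorder_eq_0I[OF G_an] by (simp add: G_def)
  qed
  show "zorder (local_form h (Some z)) 0 = (if z ^ k = of_real b then 1 else 0)"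
  proof (cases "z ^ k = of_real b")
    case True
    have "zorder (local_form h (Some z)) 0 = 1"
    proof (rule zorder_simple_zero)
      show "(\<lambda>w. - power_quotient k z w / ((z + w) * ((z + w) ^ k - 1)\<^sup>2)) analytic_on {0}"
        by (intro analytic_intros power_quotient_analytic) (use z in auto)
      show "- power_quotient k z 0 / ((z + 0) * ((z + 0) ^ k - 1)\<^sup>2) \<noteq> 0"
        using z k by (simp add: power_quotient_0)
      show "local_form h (Some z) w = w * (- power_quotient k z w / ((z + w) * ((z + w) ^ k - 1)\<^sup>2))" for w
      proof -
        have "of_real b - (z + w) ^ k = - (w * power_quotient k z w)"
          using power_quotient[of z w k] by (simp add: True algebra_simps)
        then show ?thesis by (simp add: h_def)
      qed
    qed
    with True show ?thesis by simp
  next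
    case False
    then have "h z \<noteq> 0" using z by (simp add: h_def)
    then show ?thesis using False zorder_eq_0I[OF h_an] by simp
  qed
qed

lemma regularity: "regularity_condition G h P"
  unfolding regularity_condition_def
proof (intro ballI conjI allI)
  fix p assume "p \<in> - P"
  then obtain z where z: "p = Some z" "z \<notin> Z" by (cases p) auto
  have "local_form h p analytic_on {0}"
    using analytic_shift[OF forms_analytic(3), of z] z by (simp add: local_representations)
  then show "holomorphic_form_at h p" unfolding holomorphic_form_at_def by (rule remove_sings_analytic_on)
  show "zero_of_mult (local_fun G p) m \<or> pole_of_mult (local_fun G p) m \<longleftrightarrow> zero_of_mult (local_form h p) m" for m
    unfolding zero_of_mult_def pole_of_mult_def
    using zorder_at_regular_point[OF z(2)] frequently_G[of p] frequently_h[of p]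
    by (auto simp: z(1) split: if_splits)
qed

lemma weierstrass_data: "weierstrass_data G h P"
  unfolding weierstrass_data_def
  using finite_P meromorphic_G meromorphic_h frequently_G frequently_h period regularity by blast

end

section \<open>The ends of the surface\<close>

context planar_catenoid_data begin

lemma root_cases: "\<zeta> ^ k = 1 \<Longrightarrow> \<zeta> \<in> Z \<and> \<zeta> \<noteq> 0 \<and> norm \<zeta> = 1"
  using cnj_root_of_unity(2)[of \<zeta> k] k by (auto simp: Z_def)

text \<open>
  The logarithmic coefficient at infinity vanishes in all coordinates: in the first two because the
  roots of unity sum to zero, in the third because the \<open>k\<close> coefficients \<open>- b / k\<close> cancel the \<open>b\<close> at \<open>0\<close>.
\<close>
lemma sum_log_coeff: "(\<Sum>\<xi>\<in>Z. log_coeff j \<xi>) = 0"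
proof -
  have s0: "(\<Sum>\<zeta>::complex | \<zeta> ^ k = 1. \<zeta>) = 0" using sum_roots_unity[of k] k by simp
  have "(\<Sum>\<zeta>::complex | \<zeta> ^ k = 1. log_coeff 1 \<zeta>) = s * Re (\<Sum>\<zeta>::complex | \<zeta> ^ k = 1. \<zeta>)"
    "(\<Sum>\<zeta>::complex | \<zeta> ^ k = 1. log_coeff 2 \<zeta>) = s * Im (\<Sum>\<zeta>::complex | \<zeta> ^ k = 1. \<zeta>)"
    by (simp_all add: log_coeff_def sum_distrib_left)
  moreover have "(\<Sum>\<zeta>::complex | \<zeta> ^ k = 1. log_coeff 3 \<zeta>) = (\<Sum>\<zeta>::complex | \<zeta> ^ k = 1. - b / real k)"
    by (rule sum.cong) (use root_cases in \<open>auto simp: log_coeff_def\<close>)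
  then have "(\<Sum>\<zeta>::complex | \<zeta> ^ k = 1. log_coeff 3 \<zeta>) = - b" using k by (simp add: card_roots_unity_eq)
  ultimately show ?thesis using exhaust_3[of j] unfolding sum_Z s0 by (auto simp: log_coeff_def)
qed

lemma end_normal_0: "end_normal G (Some 0) = vector [0, 0, -1]"
proof -
  have an: "local_fun G (Some 0) analytic_on {0}" using analytic_shift[OF G_analytic, of 0] by (simp add: local_representations)
  have "sphere_value G (Some 0) = Some 0"
    using an analytic_at_imp_no_pole[OF an] by (simp add: sphere_value_def G_def)
  then show ?thesis by (simp add: end_normal_def vec_eq_iff forall_3)
qed

text \<open>
  At \<open>0\<close> only \<open>dh / G\<close> has a double pole. The coefficient of \<open>1 / z\<close> in its primitive is
  \<open>(- 1 + k + 1) / (\<rho> * k) = 1 / \<rho>\<close>.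
\<close>
lemma end_at_0:
  assumes "x \<notin> Z"
  shows "null_end (weierstrass_map G h P (Some x)) (Some 0)
    (weierstrass_vector (1 / of_real \<rho>) 0 0) (inv_stereographic (Some 0)) (- b)"
proof
  show "(\<Sum>j\<in>UNIV. (weierstrass_vector (1 / of_real \<rho>) 0 0 j)\<^sup>2) = 0"
    by (simp add: weierstrass_vector_null)
  show "(\<Sum>j\<in>UNIV. weierstrass_vector (1 / of_real \<rho>) 0 0 j * of_real (inv_stereographic (Some 0) $ j)) = 0"
    using weierstrass_vector_orthogonal_normal[of "1 / of_real \<rho>" 0] by simp
  show "\<exists>i. weierstrass_vector (1 / of_real \<rho>) 0 0 i \<noteq> 0"
    by (rule exI[of _ 1]) (use \<rho>_pos in \<open>simp add: weierstrass_vector_def\<close>)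
  show "norm (inv_stereographic (Some 0)) = 1" by (rule norm_inv_stereographic)
  fix j
  define qA qB qC where "qA w = 1 / (of_real \<rho> * of_nat k) * (1 / (w ^ k - 1) + (of_nat k + 1))"
    and "qB w = w * QB w" and "qC w = w * Qh w" for w
  have "(\<lambda>w. weierstrass_vector (qA w) (qB w) (qC w) j) analytic_on {0}"
    unfolding qA_def qB_def qC_def QB_def Qh_def
    by (intro weierstrass_vector_analytic analytic_intros) (use \<rho>_pos k in \<open>auto simp: power_0_left\<close>)
  moreover have "\<forall>\<^sub>F w in at 0. rational_part j (0 + w) = weierstrass_vector (qA w) (qB w) (qC w) j / w"
    using eventually_neq_at_within[of 0 0 UNIV]
  proof (rule eventually_mono)
    fix w :: complex assume "w \<noteq> 0"
    then have "QA w = qA w / w" "QB w = qB w / w" "Qh w = qC w / w"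
      by (simp_all add: qA_def qB_def qC_def QA_def add_divide_distrib) (simp add: mult.commute)
    then show "rational_part j (0 + w) = weierstrass_vector (qA w) (qB w) (qC w) j / w"
      unfolding weierstrass_vector_divide by (simp add: rational_part_def)
  qed
  moreover have "qA 0 = 1 / of_real \<rho>" "qB 0 = 0" "qC 0 = 0"
    using k by (simp_all add: qA_def qB_def qC_def power_0_left)
  moreover have "log_coeff j 0 = - b * inv_stereographic (Some 0) $ j"
    using exhaust_3[of j] by (auto simp: log_coeff_def)
  ultimately show "log_pole_expansion (\<lambda>w. weierstrass_map G h P (Some x) (sphere_chart (Some 0) w) $ j)
      (weierstrass_vector (1 / of_real \<rho>) 0 0 j) (- b * inv_stereographic (Some 0) $ j)"
    using map_expansion_at_point[OF assms, of 0 "\<lambda>w. weierstrass_vector (qA w) (qB w) (qC w) j" j]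
    by (simp add: Z_def)
qed

lemma end_normal_infinity: "end_normal G None = vector [0, 0, 1]"
proof -
  have pole: "is_pole (\<lambda>w::complex. of_real \<rho> * (1 - of_real b * w ^ k) / w ^ (k + 1)) 0"
  proof (rule is_pole_divide)
    show "isCont (\<lambda>w::complex. of_real \<rho> * (1 - of_real b * w ^ k)) 0" by (intro continuous_intros)
    show "filterlim (\<lambda>w::complex. w ^ (k + 1)) (at 0) (at 0)"
      by (auto simp: filterlim_at eventually_at_filter intro!: tendsto_eq_intros)
    show "of_real \<rho> * (1 - of_real b * 0 ^ k) \<noteq> (0::complex)" using \<rho>_pos k by (simp add: power_0_left)
  qed
  have "\<forall>\<^sub>F w in at 0. of_real \<rho> * (1 - of_real b * w ^ k) / w ^ (k + 1) = local_fun G None w"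
    using eventually_neq_at_within[of 0 0 UNIV]
    by (rule eventually_mono) (simp add: G_def power_divide field_simps)
  then have "is_pole (local_fun G None) 0" by (rule is_pole_cong[THEN iffD1, OF _ refl pole])
  then show ?thesis by (simp add: end_normal_def sphere_value_def)
qed

text \<open>
  At infinity only \<open>G dh\<close> has a double pole; its primitive grows like \<open>- \<rho> * z\<close>.
\<close>
lemma end_at_infinity:
  assumes "x \<notin> Z"
  shows "null_end (weierstrass_map G h P (Some x)) None
    (weierstrass_vector 0 (- of_real \<rho>) 0) (inv_stereographic None) 0"
proof
  show "(\<Sum>j\<in>UNIV. (weierstrass_vector 0 (- of_real \<rho>) 0 j)\<^sup>2) = 0"
    by (simp add: weierstrass_vector_null)
  show "(\<Sum>j\<in>UNIV. weierstrass_vector 0 (- of_real \<rho>) 0 j * of_real (inv_stereographic None $ j)) = 0"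
    by (simp add: sum_3 weierstrass_vector_def)
  show "\<exists>i. weierstrass_vector 0 (- of_real \<rho>) 0 i \<noteq> 0"
    by (rule exI[of _ 1]) (use \<rho>_pos in \<open>simp add: weierstrass_vector_def\<close>)
  show "norm (inv_stereographic None) = 1" by (rule norm_inv_stereographic)
  fix j
  define qA qB qC where
    "qA w = w * (1 / (of_real \<rho> * of_nat k) * (w * (w ^ k / (1 - w ^ k)) + (of_nat k + 1) * w))"
    and "qB w = - of_real \<rho> * (1 - (1 - of_real b)\<^sup>2 / of_nat k * (w ^ k / (1 - w ^ k)))"
    and "qC w = w * ((1 - of_real b) / of_nat k * (w ^ k / (1 - w ^ k)))" for w :: complex
  have "(\<lambda>w. weierstrass_vector (qA w) (qB w) (qC w) j) analytic_on {0}"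
    unfolding qA_def qB_def qC_def
    by (intro weierstrass_vector_analytic analytic_intros) (use \<rho>_pos k in \<open>auto simp: power_0_left\<close>)
  moreover have "\<forall>\<^sub>F w in at 0. rational_part j (1 / w) = weierstrass_vector (qA w) (qB w) (qC w) j / w"
    using eventually_neq_at_within[of 0 0 UNIV]
  proof (rule eventually_mono)
    fix w :: complex assume w: "w \<noteq> 0"
    then have "1 / ((1 / w) ^ k - 1) = w ^ k / (1 - w ^ k)"
    proof -
      have "(1 / w) ^ k - 1 = (1 - w ^ k) / w ^ k" using w by (simp add: power_divide diff_divide_distrib)
      then show ?thesis by simp
    qed
    then have inv: "1 / (1 / w * ((1 / w) ^ k - 1)) = w * (w ^ k / (1 - w ^ k))"
      "1 / w / ((1 / w) ^ k - 1) = w ^ k / (1 - w ^ k) / w" "1 / ((1 / w) ^ k - 1) = w ^ k / (1 - w ^ k)"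
      by (simp_all add: divide_inverse inverse_mult_distrib mult_ac)
    have "QA (1 / w) = qA w / w" "QB (1 / w) = qB w / w" "Qh (1 / w) = qC w / w"
      unfolding qA_def qB_def qC_def QA_def QB_def Qh_def inv using w
      by (simp_all add: diff_divide_distrib right_diff_distrib)
    then show "rational_part j (1 / w) = weierstrass_vector (qA w) (qB w) (qC w) j / w"
      unfolding weierstrass_vector_divide by (simp add: rational_part_def)
  qed
  moreover have "qA 0 = 0" "qB 0 = - of_real \<rho>" "qC 0 = 0"
    using k by (simp_all add: qA_def qB_def qC_def power_0_left)
  ultimately show "log_pole_expansion (\<lambda>w. weierstrass_map G h P (Some x) (sphere_chart None w) $ j)
      (weierstrass_vector 0 (- of_real \<rho>) 0 j) (0 * inv_stereographic None $ j)"
    using map_expansion_at_infinity[OF assms, of "\<lambda>w. weierstrass_vector (qA w) (qB w) (qC w) j" j]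
    by (simp add: sum_log_coeff)
qed

text \<open>
  The absolute value of \<open>G\<close> at the roots of unity.
\<close>
definition gauss_norm where "gauss_norm = \<rho> * (1 - b)"

lemma end_normal_root: "end_normal G (Some \<zeta>) = inv_stereographic (Some (of_real gauss_norm * \<zeta>))" if "\<zeta> ^ k = 1"
proof -
  have an: "local_fun G (Some \<zeta>) analytic_on {0}" using analytic_shift[OF G_analytic, of \<zeta>] by (simp add: local_representations)
  have "sphere_value G (Some \<zeta>) = Some (of_real gauss_norm * \<zeta>)"
    using an analytic_at_imp_no_pole[OF an] that by (simp add: sphere_value_def G_def gauss_norm_def mult_ac)
  then show ?thesis by (simp add: end_normal_def)
qed

lemma gauss_norm_pos: "gauss_norm > 0" using \<rho>_pos b by (simp add: gauss_norm_def)

text \<open>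
  Multiplied by \<open>\<zeta>\<close>, this says that the growth vector \<open>(s * \<zeta>, - b / k)\<close> is parallel to the normal, whose
  horizontal and vertical parts are in the ratio \<open>2 * gauss_norm * \<zeta>\<close> to \<open>gauss_norm\<^sup>2 - 1\<close>. With
  \<open>M = k + 1 + b * (k - 1)\<close>, the choice of \<open>\<rho>\<close> gives \<open>gauss_norm\<^sup>2 * M = (1 - b) * (k + 1)\<close>, which is \<open>M - 2 * b * k\<close>.
\<close>
lemma gauss_norm_relation: "s * (gauss_norm\<^sup>2 - 1) = - (b / real k) * (2 * gauss_norm)"
proof -
  define M where "M = real k + 1 + b * (real k - 1)"
  have 1: "\<rho>\<^sup>2 * (1 - b) * M = real k + 1" using \<rho>_sq by (simp add: M_def mult_ac)
  have "gauss_norm\<^sup>2 * M = (1 - b) * (\<rho>\<^sup>2 * (1 - b) * M)" by (simp add: gauss_norm_def power2_eq_square mult_ac)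
  then have "(gauss_norm\<^sup>2 - 1) * M = - (2 * b * real k)" unfolding 1 by (simp add: M_def algebra_simps)
  moreover have "s * (gauss_norm\<^sup>2 - 1) = \<rho> * (1 - b) / (real k)\<^sup>2 * ((gauss_norm\<^sup>2 - 1) * M)"
    unfolding s_alt M_def[symmetric] by (simp add: mult_ac)
  ultimately have "s * (gauss_norm\<^sup>2 - 1) = \<rho> * (1 - b) / (real k)\<^sup>2 * (- (2 * b * real k))" by simp
  also have "\<dots> = - (b / real k) * (2 * gauss_norm)" using k by (simp add: gauss_norm_def power2_eq_square field_simps)
  finally show ?thesis .
qed

text \<open>
  Otherwise the two sides of the preceding relation would have different signs.
\<close>
lemma gauss_norm_less_1: "gauss_norm\<^sup>2 < 1"
proof (rule ccontr)
  assume "\<not> gauss_norm\<^sup>2 < 1"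
  moreover have "s > 0" using \<rho>_pos k by (simp add: s_def)
  ultimately have "s * (gauss_norm\<^sup>2 - 1) \<ge> 0" by simp
  moreover have "b / real k * (2 * gauss_norm) > 0" using b k gauss_norm_pos by simp
  ultimately show False using gauss_norm_relation by linarith
qed

text \<open>
  The logarithmic growth at a root of unity, obtained from the third coordinate:
  \<open>- b / k\<close> divided by the third component of the normal.
\<close>
definition growth :: real where "growth = (b / real k) * (gauss_norm\<^sup>2 + 1) / (1 - gauss_norm\<^sup>2)"

lemma growth_pos: "growth > 0"
  unfolding growth_def using b k gauss_norm_less_1 by (intro divide_pos_pos mult_pos_pos add_nonneg_pos) auto

text \<open>
  Near \<open>\<zeta>\<close> one has \<open>z ^ k - 1 = w * D w\<close> with \<open>D 0 = k / \<zeta>\<close>, so the three rational parts have simple poles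
  with coefficients \<open>\<sigma>\<close>, \<open>\<sigma> * c\<^sup>2\<close> and \<open>\<sigma> * c\<close>, where \<open>c\<close> is the value of \<open>G\<close> at \<open>\<zeta>\<close>.
\<close>
lemma end_at_root:
  assumes "x \<notin> Z" and \<zeta>: "\<zeta> ^ k = 1"
  defines "\<sigma> \<equiv> 1 / (of_real \<rho> * (of_nat k)\<^sup>2)" and "c \<equiv> of_real gauss_norm * \<zeta>"
  shows "null_end (weierstrass_map G h P (Some x)) (Some \<zeta>)
    (weierstrass_vector \<sigma> (\<sigma> * c\<^sup>2) (\<sigma> * c)) (inv_stereographic (Some c)) growth"
proof
  have z: "\<zeta> \<in> Z" "\<zeta> \<noteq> 0" "norm \<zeta> = 1" using root_cases[OF \<zeta>] by auto
  show "(\<Sum>j\<in>UNIV. (weierstrass_vector \<sigma> (\<sigma> * c\<^sup>2) (\<sigma> * c) j)\<^sup>2) = 0"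
    unfolding weierstrass_vector_null by (simp add: power2_eq_square)
  show "(\<Sum>j\<in>UNIV. weierstrass_vector \<sigma> (\<sigma> * c\<^sup>2) (\<sigma> * c) j * of_real (inv_stereographic (Some c) $ j)) = 0"
    by (rule weierstrass_vector_orthogonal_normal)
  have "\<sigma> \<noteq> 0" "c \<noteq> 0" using \<rho>_pos k gauss_norm_pos z by (auto simp: \<sigma>_def c_def)
  then show "\<exists>i. weierstrass_vector \<sigma> (\<sigma> * c\<^sup>2) (\<sigma> * c) i \<noteq> 0"
    by (intro exI[of _ 3]) (simp add: weierstrass_vector_def)
  show "norm (inv_stereographic (Some c)) = 1" by (rule norm_inv_stereographic)
  fix j
  define D where "D = power_quotient k \<zeta>"
  have D: "(\<zeta> + w) ^ k - 1 = w * D w" for w using power_quotient[of \<zeta> w k] \<zeta> by (simp add: D_def)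
  have D0: "D 0 * \<zeta> = of_nat k"
    using \<zeta> power_k(2)[of \<zeta>] by (simp add: D_def power_quotient_0)
  have D_an: "D analytic_on {0}" unfolding D_def by (rule power_quotient_analytic)
  have "D 0 * \<zeta> \<noteq> 0" unfolding D0 using k by simp
  then have D0': "D 0 \<noteq> 0" "1 / D 0 = \<zeta> / of_nat k" using z by (auto simp flip: D0)
  define qA qB qC where
    "qA w = 1 / (of_real \<rho> * of_nat k) * (1 / D w * (1 / (\<zeta> + w)) + w * ((of_nat k + 1) / (\<zeta> + w)))"
    and "qB w = - of_real \<rho> * (w * (\<zeta> + w) - (1 - of_real b)\<^sup>2 / of_nat k * ((\<zeta> + w) * (1 / D w)))"
    and "qC w = (1 - of_real b) / of_nat k * (1 / D w)" for w :: complex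
  have "(\<lambda>w. weierstrass_vector (qA w) (qB w) (qC w) j) analytic_on {0}"
    unfolding qA_def qB_def qC_def
    by (intro weierstrass_vector_analytic analytic_intros D_an) (use \<rho>_pos k D0' z in auto)
  moreover have "\<forall>\<^sub>F w in at 0. rational_part j (\<zeta> + w) = weierstrass_vector (qA w) (qB w) (qC w) j / w"
    using eventually_neq_at_within[of 0 0 UNIV]
  proof (rule eventually_mono)
    fix w :: complex assume w: "w \<noteq> 0"
    have inv: "1 / ((\<zeta> + w) * (w * D w)) = 1 / D w * (1 / (\<zeta> + w)) / w"
      "(\<zeta> + w) / (w * D w) = (\<zeta> + w) * (1 / D w) / w" "1 / (w * D w) = 1 / D w / w"
      by (simp_all add: mult_ac)
    have "QA (\<zeta> + w) = qA w / w" "QB (\<zeta> + w) = qB w / w" "Qh (\<zeta> + w) = qC w / w"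
      unfolding qA_def qB_def qC_def QA_def QB_def Qh_def D inv using w
      by (simp_all add: diff_divide_distrib add_divide_distrib right_diff_distrib distrib_left mult.assoc)
    then show "rational_part j (\<zeta> + w) = weierstrass_vector (qA w) (qB w) (qC w) j / w"
      unfolding weierstrass_vector_divide by (simp add: rational_part_def)
  qed
  moreover have "qA 0 = \<sigma>" "qB 0 = \<sigma> * c\<^sup>2" "qC 0 = \<sigma> * c"
    using k z \<rho>_pos unfolding qA_def qB_def qC_def D0' \<sigma>_def c_def gauss_norm_def
    by (simp_all add: field_simps power2_eq_square)
  moreover have "log_coeff j \<zeta> = growth * inv_stereographic (Some c) $ j"
  proof -
    have nc: "(norm c)\<^sup>2 = gauss_norm\<^sup>2" using z gauss_norm_pos by (simp add: c_def norm_mult power_mult_distrib)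
    have ne: "1 - gauss_norm\<^sup>2 \<noteq> 0" "gauss_norm\<^sup>2 + 1 \<noteq> 0" using gauss_norm_less_1 by (auto simp: add_nonneg_eq_0_iff)
    have "s * (1 - gauss_norm\<^sup>2) = b / real k * (2 * gauss_norm)" using gauss_norm_relation by (simp add: algebra_simps)
    then have "s = b / real k * (2 * gauss_norm) / (1 - gauss_norm\<^sup>2)" by (simp only: nonzero_eq_divide_eq[OF ne(1)])
    then have s: "s = b / real k / (1 - gauss_norm\<^sup>2) * (2 * gauss_norm)" by simp
    have gr: "growth * (1 / (gauss_norm\<^sup>2 + 1) * y) = b / real k / (1 - gauss_norm\<^sup>2) * y" for y
      using ne by (simp add: growth_def)
    have comps: "inv_stereographic (Some c) $ 1 = 1 / (gauss_norm\<^sup>2 + 1) * (2 * (gauss_norm * Re \<zeta>))"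
      "inv_stereographic (Some c) $ 2 = 1 / (gauss_norm\<^sup>2 + 1) * (2 * (gauss_norm * Im \<zeta>))"
      "inv_stereographic (Some c) $ 3 = 1 / (gauss_norm\<^sup>2 + 1) * (gauss_norm\<^sup>2 - 1)"
      by (simp_all add: nc) (simp_all add: c_def)
    have "b / real k / (1 - gauss_norm\<^sup>2) * (gauss_norm\<^sup>2 - 1) = - b / real k" using ne k by (simp add: field_simps)
    then have "log_coeff 1 \<zeta> = growth * inv_stereographic (Some c) $ 1" "log_coeff 2 \<zeta> = growth * inv_stereographic (Some c) $ 2"
      "log_coeff 3 \<zeta> = growth * inv_stereographic (Some c) $ 3"
      unfolding comps gr using z(2) by (simp_all add: log_coeff_def s)
    then show ?thesis using exhaust_3[of j] by auto
  qed
  ultimately show "log_pole_expansion (\<lambda>w. weierstrass_map G h P (Some x) (sphere_chart (Some \<zeta>) w) $ j)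
      (weierstrass_vector \<sigma> (\<sigma> * c\<^sup>2) (\<sigma> * c) j) (growth * inv_stereographic (Some c) $ j)"
    using map_expansion_at_point[OF assms(1) z(1), of "\<lambda>w. weierstrass_vector (qA w) (qB w) (qC w) j" j] by simp
qed

lemma planar_end_at_infinity:
  assumes "x \<notin> Z"
  shows "planar_end G (weierstrass_map G h P (Some x)) None"
proof -
  interpret null_end "weierstrass_map G h P (Some x)" None
    "weierstrass_vector 0 (- of_real \<rho>) 0" "inv_stereographic None" 0
    by (rule end_at_infinity[OF assms])
  show ?thesis using graph_end by (simp add: planar_end_def end_normal_infinity)
qed

lemma catenoid_end_at_0:
  assumes "x \<notin> Z"
  shows "catenoid_end G (weierstrass_map G h P (Some x)) (Some 0)"
    "downward_pointing G (weierstrass_map G h P (Some x)) (Some 0)"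
proof -
  interpret null_end "weierstrass_map G h P (Some x)" "Some 0"
    "weierstrass_vector (1 / of_real \<rho>) 0 0" "inv_stereographic (Some 0)" "- b"
    by (rule end_at_0[OF assms])
  have N: "end_normal G (Some 0) = inv_stereographic (Some 0)"
    by (simp add: end_normal_0 vec_eq_iff forall_3)
  show "catenoid_end G (weierstrass_map G h P (Some x)) (Some 0)"
    unfolding catenoid_end_def N using graph_end b by (intro exI[of _ b]) simp
  have "filterlim (\<lambda>y. weierstrass_map G h P (Some x) y \<bullet> (1 *\<^sub>R inv_stereographic (Some 0))) at_top
      (atin riemann_sphere (Some 0))"
    by (rule height_at_top) (use b in simp)
  then show "downward_pointing G (weierstrass_map G h P (Some x)) (Some 0)"
    unfolding downward_pointing_def points_in_direction_def N
    by (intro exI[of _ "inv_stereographic (Some 0)"]) simp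
qed

text \<open>
  The normal points into the lower half space because \<open>\<bar>G\<bar> < 1\<close> at a root of unity, and the growth
  is positive, so the height in the direction \<open>- N\<close> tends to infinity.
\<close>
lemma catenoid_end_at_root:
  assumes "x \<notin> Z" and \<zeta>: "\<zeta> ^ k = 1"
  shows "catenoid_end G (weierstrass_map G h P (Some x)) (Some \<zeta>)"
    "\<not> is_vertical (end_normal G (Some \<zeta>))"
    "upward_pointing G (weierstrass_map G h P (Some x)) (Some \<zeta>)"
proof -
  interpret null_end "weierstrass_map G h P (Some x)" "Some \<zeta>"
    "weierstrass_vector (1 / (of_real \<rho> * (of_nat k)\<^sup>2)) (1 / (of_real \<rho> * (of_nat k)\<^sup>2) * (of_real gauss_norm * \<zeta>)\<^sup>2)
      (1 / (of_real \<rho> * (of_nat k)\<^sup>2) * (of_real gauss_norm * \<zeta>))" "inv_stereographic (Some (of_real gauss_norm * \<zeta>))" growth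
    by (rule end_at_root[OF assms])
  note N = end_normal_root[OF \<zeta>]
  have D: "(norm (of_real gauss_norm * \<zeta>))\<^sup>2 + 1 > 0" by (simp add: add_nonneg_pos)
  show "catenoid_end G (weierstrass_map G h P (Some x)) (Some \<zeta>)"
    unfolding catenoid_end_def N using graph_end growth_pos by (intro exI[of _ "- growth"]) simp
  have "\<zeta> \<noteq> 0" "norm \<zeta> = 1" using root_cases[OF \<zeta>] by auto
  then have "gauss_norm * Re \<zeta> \<noteq> 0 \<or> gauss_norm * Im \<zeta> \<noteq> 0" using gauss_norm_pos by (auto simp: complex_eq_iff)
  then have "inv_stereographic (Some (of_real gauss_norm * \<zeta>)) $ 1 \<noteq> 0 \<or> inv_stereographic (Some (of_real gauss_norm * \<zeta>)) $ 2 \<noteq> 0"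
    using D by auto
  then show "\<not> is_vertical (end_normal G (Some \<zeta>))"
    unfolding N is_vertical_def by (auto simp del: inv_stereographic.simps)
  have "(norm (of_real gauss_norm * \<zeta>))\<^sup>2 = gauss_norm\<^sup>2" using \<open>norm \<zeta> = 1\<close> by (simp add: norm_mult)
  then have "inv_stereographic (Some (of_real gauss_norm * \<zeta>)) $ 3 < 0"
    using gauss_norm_less_1 D by (simp add: divide_neg_pos)
  moreover have "filterlim (\<lambda>y. weierstrass_map G h P (Some x) y \<bullet> ((- 1) *\<^sub>R inv_stereographic (Some (of_real gauss_norm * \<zeta>)))) at_top
      (atin riemann_sphere (Some \<zeta>))"
    by (rule height_at_top) (use growth_pos in simp)
  ultimately show "upward_pointing G (weierstrass_map G h P (Some x)) (Some \<zeta>)"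
    unfolding upward_pointing_def points_in_direction_def N
    by (intro exI[of _ "- inv_stereographic (Some (of_real gauss_norm * \<zeta>))"]) (simp del: inv_stereographic.simps)
qed

end

section \<open>The minimal surface\<close>

theorem theorem3p1:
  fixes k :: nat and a :: real
  assumes "k > 1" and "0 < a" and "a < 1"
  shows "\<exists>\<rho>::real. \<rho> > 0 \<and>
    (let G = (\<lambda>z::complex. of_real \<rho> * z * (z ^ k - of_real a ^ k));
         h = (\<lambda>z::complex. (of_real a ^ k - z ^ k) / (z * (z ^ k - 1)\<^sup>2));
         P = {Some 0, None} \<union> Some ` {z::complex. z ^ k = 1}
     in weierstrass_data G h P \<and>
        (\<forall>z0 \<in> - P.
           let X = weierstrass_map G h P z0
           in planar_end G X None \<and> is_vertical (end_normal G None) \<and>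
              catenoid_end G X (Some 0) \<and> is_vertical (end_normal G (Some 0)) \<and>
              downward_pointing G X (Some 0) \<and>
              (\<forall>\<zeta>. \<zeta> ^ k = 1 \<longrightarrow>
                 catenoid_end G X (Some \<zeta>) \<and> \<not> is_vertical (end_normal G (Some \<zeta>)) \<and>
                 upward_pointing G X (Some \<zeta>))))"
proof -
  have "0 < a ^ k" "a ^ k < 1" using assms power_strict_decreasing[of 0 k a] by auto
  then interpret planar_catenoid_data k "a ^ k" using assms(1) by unfold_locales auto
  have G: "(\<lambda>z::complex. of_real \<rho> * z * (z ^ k - of_real a ^ k)) = G"
    and h: "(\<lambda>z::complex. (of_real a ^ k - z ^ k) / (z * (z ^ k - 1)\<^sup>2)) = h"
    by (simp_all add: fun_eq_iff G_def h_def)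
  have vertical: "is_vertical (end_normal G None)" "is_vertical (end_normal G (Some 0))"
    by (simp_all add: is_vertical_def end_normal_infinity end_normal_0)
  have "\<forall>z0 \<in> - P. let X = weierstrass_map G h P z0
           in planar_end G X None \<and> is_vertical (end_normal G None) \<and>
              catenoid_end G X (Some 0) \<and> is_vertical (end_normal G (Some 0)) \<and>
              downward_pointing G X (Some 0) \<and>
              (\<forall>\<zeta>. \<zeta> ^ k = 1 \<longrightarrow>
                 catenoid_end G X (Some \<zeta>) \<and> \<not> is_vertical (end_normal G (Some \<zeta>)) \<and>
                 upward_pointing G X (Some \<zeta>))"
  proof
    fix z0 assume "z0 \<in> - P"
    then obtain x where x: "z0 = Some x" "x \<notin> Z" by (cases z0) auto
    show "let X = weierstrass_map G h P z0
           in planar_end G X None \<and> is_vertical (end_normal G None) \<and>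
              catenoid_end G X (Some 0) \<and> is_vertical (end_normal G (Some 0)) \<and>
              downward_pointing G X (Some 0) \<and>
              (\<forall>\<zeta>. \<zeta> ^ k = 1 \<longrightarrow>
                 catenoid_end G X (Some \<zeta>) \<and> \<not> is_vertical (end_normal G (Some \<zeta>)) \<and>
                 upward_pointing G X (Some \<zeta>))"
      unfolding Let_def x(1)
      by (intro conjI allI impI vertical planar_end_at_infinity[OF x(2)] catenoid_end_at_0[OF x(2)]
          catenoid_end_at_root[OF x(2)])
  qed
  note conjI[OF \<rho>_pos conjI[OF weierstrass_data this]]
  then show ?thesis
    unfolding G[symmetric] h[symmetric] P_def Let_def by (intro exI[of _ \<rho>])
qed

end
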